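(* Let $\Pi$, with density $\pi(\theta\mid x)$, be the common stationary distribution of $\mathbb{P}_{\mathsf{MwG}}$ and $\mathbb{P}_{\mathsf{aux}}$. Then $$\mathsf{Gap}(\mathbb{P}_{\mathsf{aux}})\ \ge\ \Bigl(1-\sup_{\theta,\theta'}d_{\mathsf{TV}}(\theta,\theta')\Bigr)\,\mathsf{Gap}(\mathbb{P}_{\mathsf{MwG}}),$$ and similarly $$\mathsf{Gap}(\mathbb{P}_{\mathsf{aux}})\ \ge\ e^{-1/e}\exp\Bigl\{-\sup_{\theta\neq\theta'}\min\bigl\{d_{\mathsf{KL}}(\theta,\theta'),\ \tilde d_{\mathsf{KL}}(\theta,\theta'),\ \tilde d_{\mathsf{KL}}(\theta',\theta)\bigr\}\Bigr\}\,\mathsf{Gap}(\mathbb{P}_{\mathsf{MwG}}).$$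
   Context: Setting. $\Theta$ is a measurable space with base measure $\lambda$; the target is a probability distribution $\Pi$ on $\Theta$ with density $\pi(\theta\mid x)$ with respect to $\lambda$ ($x$ is fixed data). $\Omega_1,\Omega_2$ are measurable spaces with base measures $\lambda_1,\lambda_2$. For each $\theta$, $\mathbb{P}_\theta$ is a probability measure on $\Omega_1$ with density $\mathbb{P}_\theta(\omega_1)$ w.r.t. $\lambda_1$. For each $(\theta,\theta')$ and $\omega_1$, $\mathbb{P}_{\theta,\theta'}(\cdot\mid\omega_1)$ is a probability measure on $\Omega_2$ with density $\mathbb{P}_{\theta,\theta'}(\omega_2\mid\omega_1)$ w.r.t. $\lambda_2$. Put $\mathbb{P}_{\theta,\theta'}(\omega_1,\omega_2):=\mathbb{P}_\theta(\omega_1)\mathbb{P}_{\theta,\theta'}(\omega_2\mid\omega_1)$. For each $\omega_1$, $q_{\omega_1}(\theta,\cdot)$ is the density w.r.t. $\lambda$ of a Markov proposal kernel on $\Theta$. All densities are jointly measurable. Chain $\mathbb{P}_{\mathsf{aux}}$. From $\theta$: sample $\omega_1\sim\mathbb{P}_\theta$; propose $\theta'\sim q_{\omega_1}(\theta,\cdot)$; sample $\omega_2\sim\mathbb{P}_{\theta,\theta'}(\cdot\mid\omega_1)$; accept $\theta'$ with probability $\min\{1,r\}$, where $r=\frac{\pi(\theta'\mid x)\mathbb{P}_{\theta',\theta}(\omega_1,\omega_2)q_{\omega_1}(\theta',\theta)}{\pi(\theta\mid x)\mathbb{P}_{\theta,\theta'}(\omega_1,\omega_2)q_{\omega_1}(\theta,\theta')}$,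 else stay at $\theta$. Chain $\mathbb{P}_{\mathsf{MwG}}$ (the case $\omega_1=\omega_2$; a Metropolis-within-Gibbs chain). From $\theta$: sample $\omega_1\sim\mathbb{P}_\theta$; propose $\theta'\sim q_{\omega_1}(\theta,\cdot)$; accept with probability $\min\{1,r_1\}$, $r_1=\frac{\pi(\theta'\mid x)\mathbb{P}_{\theta'}(\omega_1)q_{\omega_1}(\theta',\theta)}{\pi(\theta\mid x)\mathbb{P}_\theta(\omega_1)q_{\omega_1}(\theta,\theta')}$, else stay. Both chains are reversible with respect to $\Pi$. Convention: whenever the denominator of an acceptance ratio is $0$, the acceptance probability is taken to be $1$. Distances. With $d_{\mathsf{TV}}(P,Q)=\sup_A|P(A)-Q(A)|$ and $d_{\mathsf{KL}}(P\Vert Q)$ the Kullback–Leibler divergence (values in $[0,\infty]$, with $e^{-\infty}=0$): $d_{\mathsf{TV}}(\theta,\theta'):=\sup_{\omega_1}d_{\mathsf{TV}}\bigl(\mathbb{P}_{\theta,\theta'}(\cdot\mid\omega_1),\mathbb{P}_{\theta',\theta}(\cdot\mid\omega_1)\bigr)$; $\tilde d_{\mathsf{KL}}(\theta,\theta'):=\sup_{\omega_1}d_{\mathsf{KL}}\bigl(\mathbb{P}_{\theta,\theta'}(\cdot\mid\omega_1)\Vert\mathbb{P}_{\theta',\theta}(\cdot\mid\omega_1)\bigr)$; $d_{\mathsf{KL}}(\theta,\theta'):=\tfrac12\sup_{\omega_1}\Bigl(d_{\mathsf{KL}}\bigl(\mathbb{P}_{\theta,\theta'}(\cdot\mid\omega_1)\Vert\mathbb{P}_{\theta',\theta}(\cdot\mid\omega_1)\bigr)+d_{\mathsf{KL}}\bigl(\mathbb{P}_{\theta',\theta}(\cdot\mid\omega_1)\Vert\mathbb{P}_{\theta,\theta'}(\cdot\mid\omega_1)\bigr)\Bigr)$.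 Suprema over $\omega_1$ are over $\Omega_1$, those over $\theta,\theta'$ are over $\Theta$. Spectral gap. For a Markov kernel $P$ with stationary distribution $\Pi$, $L^2_0(\Pi)=\{f:\int f^2\,d\Pi<\infty,\ \int f\,d\Pi=0\}$ with norm $\lVert f\rVert_\Pi=(\int f^2 d\Pi)^{1/2}$, $(Pf)(\theta)=\int P(\theta,d\theta')f(\theta')$, $\lVert P\rVert_{L^2_0(\Pi)}=\sup\{\lVert Pf\rVert_\Pi: f\in L^2_0(\Pi),\lVert f\rVert_\Pi=1\}$, and $\mathsf{Gap}(P):=1-\lVert P\rVert_{L^2_0(\Pi)}$. *)

theory Defs
  imports "HOL-Probability.Probability"
begin

section \<open>Distances between probability measures\<close>

definition dTV :: "'a measure \<Rightarrow> 'a measure \<Rightarrow> real" where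
  "dTV P Q = (SUP A\<in>sets P. \<bar>measure P A - measure Q A\<bar>)"

text \<open>
  The library's \<^const>\<open>KL_divergence\<close> is a Bochner integral, with the reference measure as its
  first measure argument, so \<open>KL_divergence (exp 1) Q P\<close> is the divergence of \<open>P\<close> from \<open>Q\<close> in
  nats whenever that is finite. Since the negative part of \<open>ln (dP/dQ)\<close> is always \<open>P\<close>-integrable,
  the divergence is infinite exactly when \<open>P\<close> is not absolutely continuous with respect to \<open>Q\<close> or
  \<open>ln (dP/dQ)\<close> is not \<open>P\<close>-integrable.
\<close>

definition dKL :: "'a measure \<Rightarrow> 'a measure \<Rightarrow> ennreal" where
  "dKL P Q =
    (if absolutely_continuous Q P \<and> integrable P (entropy_density (exp 1) Q P)
     then ennreal (KL_divergence (exp 1) Q P) else \<infinity>)"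

definition exp_minus :: "ennreal \<Rightarrow> real" where
  "exp_minus x = (if x = \<infinity> then 0 else exp (- enn2real x))"


section \<open>Spectral gap\<close>

definition L2_0 :: "'a measure \<Rightarrow> ('a \<Rightarrow> real) set" where
  "L2_0 \<nu> = {f \<in> borel_measurable \<nu>. integrable \<nu> (\<lambda>\<theta>. (f \<theta>)\<^sup>2) \<and> (\<integral>\<theta>. f \<theta> \<partial>\<nu>) = 0}"

definition L2_norm :: "'a measure \<Rightarrow> ('a \<Rightarrow> real) \<Rightarrow> real" where
  "L2_norm \<nu> f = sqrt (\<integral>\<theta>. (f \<theta>)\<^sup>2 \<partial>\<nu>)"

definition kernel_op :: "('a \<Rightarrow> 'a measure) \<Rightarrow> ('a \<Rightarrow> real) \<Rightarrow> 'a \<Rightarrow> real" where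
  "kernel_op K f \<theta> = (\<integral>\<theta>'. f \<theta>' \<partial>K \<theta>)"

text \<open>
  The inserted \<open>0\<close> only matters when no \<open>f\<close> in \<^term>\<open>L2_0 \<nu>\<close> has norm \<open>1\<close> (the space is then
  trivial): the operator norm is \<open>0\<close>, whereas the real supremum of the empty set is unspecified.
  If \<open>\<nu>\<close> is stationary for \<open>K\<close>, the set is bounded above by \<open>1\<close>.
\<close>

definition op_norm_L2_0 :: "'a measure \<Rightarrow> ('a \<Rightarrow> 'a measure) \<Rightarrow> real" where
  "op_norm_L2_0 \<nu> K =
    Sup (insert 0 {L2_norm \<nu> (kernel_op K f) | f. f \<in> L2_0 \<nu> \<and> L2_norm \<nu> f = 1})"

definition Gap :: "'a measure \<Rightarrow> ('a \<Rightarrow> 'a measure) \<Rightarrow> real" where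
  "Gap \<nu> K = 1 - op_norm_L2_0 \<nu> K"


section \<open>The two chains\<close>

abbreviation rdensity :: "'a measure \<Rightarrow> ('a \<Rightarrow> real) \<Rightarrow> 'a measure" where
  "rdensity M f \<equiv> density M (\<lambda>x. ennreal (f x))"

definition accept_prob :: "real \<Rightarrow> real \<Rightarrow> real" where
  "accept_prob num den = (if den = 0 then 1 else min 1 (num / den))"

definition accept_step :: "'a measure \<Rightarrow> real \<Rightarrow> 'a \<Rightarrow> 'a \<Rightarrow> 'a measure" where
  "accept_step \<mu> a \<theta> \<theta>' =
    distr (measure_pmf (bernoulli_pmf a)) \<mu> (\<lambda>accept. if accept then \<theta>' else \<theta>)"

definition joint_density ::
  "('a \<Rightarrow> 'b \<Rightarrow> real) \<Rightarrow> ('a \<Rightarrow> 'a \<Rightarrow> 'b \<Rightarrow> 'c \<Rightarrow> real) \<Rightarrow> 'a \<Rightarrow> 'a \<Rightarrow> 'b \<Rightarrow> 'c \<Rightarrow> real" where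
  "joint_density p1 p2 \<theta> \<theta>' \<omega>1 \<omega>2 = p1 \<theta> \<omega>1 * p2 \<theta> \<theta>' \<omega>1 \<omega>2"

text \<open>
  Here \<open>\<pi> \<theta>\<close> is the target density (the data being fixed), \<open>p1 \<theta> \<omega>1\<close> the density of the first
  auxiliary variable, \<open>p2 \<theta> \<theta>' \<omega>1 \<omega>2\<close> the conditional density of the second one at \<open>\<omega>2\<close> given
  \<open>\<omega>1\<close>, and \<open>q \<omega>1 \<theta> \<theta>'\<close> the density at \<open>\<theta>'\<close> of the proposal from \<open>\<theta>\<close>.
\<close>

definition P_aux ::
  "'a measure \<Rightarrow> 'b measure \<Rightarrow> 'c measure \<Rightarrow> ('a \<Rightarrow> real) \<Rightarrow> ('a \<Rightarrow> 'b \<Rightarrow> real) \<Rightarrow>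
   ('a \<Rightarrow> 'a \<Rightarrow> 'b \<Rightarrow> 'c \<Rightarrow> real) \<Rightarrow> ('b \<Rightarrow> 'a \<Rightarrow> 'a \<Rightarrow> real) \<Rightarrow> 'a \<Rightarrow> 'a measure" where
  "P_aux \<mu> \<mu>1 \<mu>2 \<pi> p1 p2 q \<theta> =
    rdensity \<mu>1 (p1 \<theta>) \<bind> (\<lambda>\<omega>1.
    rdensity \<mu> (q \<omega>1 \<theta>) \<bind> (\<lambda>\<theta>'.
    rdensity \<mu>2 (p2 \<theta> \<theta>' \<omega>1) \<bind> (\<lambda>\<omega>2.
    accept_step \<mu>
      (accept_prob
        (\<pi> \<theta>' * joint_density p1 p2 \<theta>' \<theta> \<omega>1 \<omega>2 * q \<omega>1 \<theta>' \<theta>)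
        (\<pi> \<theta> * joint_density p1 p2 \<theta> \<theta>' \<omega>1 \<omega>2 * q \<omega>1 \<theta> \<theta>'))
      \<theta> \<theta>')))"

definition P_MwG ::
  "'a measure \<Rightarrow> 'b measure \<Rightarrow> ('a \<Rightarrow> real) \<Rightarrow> ('a \<Rightarrow> 'b \<Rightarrow> real) \<Rightarrow>
   ('b \<Rightarrow> 'a \<Rightarrow> 'a \<Rightarrow> real) \<Rightarrow> 'a \<Rightarrow> 'a measure" where
  "P_MwG \<mu> \<mu>1 \<pi> p1 q \<theta> =
    rdensity \<mu>1 (p1 \<theta>) \<bind> (\<lambda>\<omega>1.
    rdensity \<mu> (q \<omega>1 \<theta>) \<bind> (\<lambda>\<theta>'.
    accept_step \<mu>
      (accept_prob
        (\<pi> \<theta>' * p1 \<theta>' \<omega>1 * q \<omega>1 \<theta>' \<theta>)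
        (\<pi> \<theta> * p1 \<theta> \<omega>1 * q \<omega>1 \<theta> \<theta>'))
      \<theta> \<theta>'))"

text \<open>Base measures are taken to be sigma-finite, as needed for Fubini's theorem.\<close>

locale aux_mcmc =
  fixes \<mu> :: "'a measure" and \<mu>1 :: "'b measure" and \<mu>2 :: "'c measure"
    and \<pi> :: "'a \<Rightarrow> real"
    and p1 :: "'a \<Rightarrow> 'b \<Rightarrow> real"
    and p2 :: "'a \<Rightarrow> 'a \<Rightarrow> 'b \<Rightarrow> 'c \<Rightarrow> real"
    and q :: "'b \<Rightarrow> 'a \<Rightarrow> 'a \<Rightarrow> real"
  assumes sigma_finite:
      "sigma_finite_measure \<mu>" "sigma_finite_measure \<mu>1" "sigma_finite_measure \<mu>2"
    and measurable_target: "\<pi> \<in> borel_measurable \<mu>"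
    and measurable_p1: "(\<lambda>(\<theta>, \<omega>1). p1 \<theta> \<omega>1) \<in> borel_measurable (\<mu> \<Otimes>\<^sub>M \<mu>1)"
    and measurable_p2:
      "(\<lambda>(\<theta>, \<theta>', \<omega>1, \<omega>2). p2 \<theta> \<theta>' \<omega>1 \<omega>2)
        \<in> borel_measurable (\<mu> \<Otimes>\<^sub>M \<mu> \<Otimes>\<^sub>M \<mu>1 \<Otimes>\<^sub>M \<mu>2)"
    and measurable_q: "(\<lambda>(\<omega>1, \<theta>, \<theta>'). q \<omega>1 \<theta> \<theta>') \<in> borel_measurable (\<mu>1 \<Otimes>\<^sub>M \<mu> \<Otimes>\<^sub>M \<mu>)"
    and nonneg_target: "\<And>\<theta>. \<theta> \<in> space \<mu> \<Longrightarrow> 0 \<le> \<pi> \<theta>"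
    and nonneg_p1: "\<And>\<theta> \<omega>1. \<lbrakk>\<theta> \<in> space \<mu>; \<omega>1 \<in> space \<mu>1\<rbrakk> \<Longrightarrow> 0 \<le> p1 \<theta> \<omega>1"
    and nonneg_p2:
      "\<And>\<theta> \<theta>' \<omega>1 \<omega>2. \<lbrakk>\<theta> \<in> space \<mu>; \<theta>' \<in> space \<mu>; \<omega>1 \<in> space \<mu>1; \<omega>2 \<in> space \<mu>2\<rbrakk>
        \<Longrightarrow> 0 \<le> p2 \<theta> \<theta>' \<omega>1 \<omega>2"
    and nonneg_q:
      "\<And>\<omega>1 \<theta> \<theta>'. \<lbrakk>\<omega>1 \<in> space \<mu>1; \<theta> \<in> space \<mu>; \<theta>' \<in> space \<mu>\<rbrakk> \<Longrightarrow> 0 \<le> q \<omega>1 \<theta> \<theta>'"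
    and prob_target: "prob_space (rdensity \<mu> \<pi>)"
    and prob_p1: "\<And>\<theta>. \<theta> \<in> space \<mu> \<Longrightarrow> prob_space (rdensity \<mu>1 (p1 \<theta>))"
    and prob_p2:
      "\<And>\<theta> \<theta>' \<omega>1. \<lbrakk>\<theta> \<in> space \<mu>; \<theta>' \<in> space \<mu>; \<omega>1 \<in> space \<mu>1\<rbrakk>
        \<Longrightarrow> prob_space (rdensity \<mu>2 (p2 \<theta> \<theta>' \<omega>1))"
    and prob_q:
      "\<And>\<omega>1 \<theta>. \<lbrakk>\<omega>1 \<in> space \<mu>1; \<theta> \<in> space \<mu>\<rbrakk> \<Longrightarrow> prob_space (rdensity \<mu> (q \<omega>1 \<theta>))"


section \<open>Distances between the conditional auxiliary distributions\<close>

definition dTV_aux ::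
  "'b measure \<Rightarrow> 'c measure \<Rightarrow> ('a \<Rightarrow> 'a \<Rightarrow> 'b \<Rightarrow> 'c \<Rightarrow> real) \<Rightarrow> 'a \<Rightarrow> 'a \<Rightarrow> real" where
  "dTV_aux \<mu>1 \<mu>2 p2 \<theta> \<theta>' =
    (SUP \<omega>1\<in>space \<mu>1. dTV (rdensity \<mu>2 (p2 \<theta> \<theta>' \<omega>1)) (rdensity \<mu>2 (p2 \<theta>' \<theta> \<omega>1)))"

definition dKL_tilde_aux ::
  "'b measure \<Rightarrow> 'c measure \<Rightarrow> ('a \<Rightarrow> 'a \<Rightarrow> 'b \<Rightarrow> 'c \<Rightarrow> real) \<Rightarrow> 'a \<Rightarrow> 'a \<Rightarrow> ennreal" where
  "dKL_tilde_aux \<mu>1 \<mu>2 p2 \<theta> \<theta>' =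
    (SUP \<omega>1\<in>space \<mu>1. dKL (rdensity \<mu>2 (p2 \<theta> \<theta>' \<omega>1)) (rdensity \<mu>2 (p2 \<theta>' \<theta> \<omega>1)))"

definition dKL_aux ::
  "'b measure \<Rightarrow> 'c measure \<Rightarrow> ('a \<Rightarrow> 'a \<Rightarrow> 'b \<Rightarrow> 'c \<Rightarrow> real) \<Rightarrow> 'a \<Rightarrow> 'a \<Rightarrow> ennreal" where
  "dKL_aux \<mu>1 \<mu>2 p2 \<theta> \<theta>' =
    (SUP \<omega>1\<in>space \<mu>1.
      dKL (rdensity \<mu>2 (p2 \<theta> \<theta>' \<omega>1)) (rdensity \<mu>2 (p2 \<theta>' \<theta> \<omega>1)) +
      dKL (rdensity \<mu>2 (p2 \<theta>' \<theta> \<omega>1)) (rdensity \<mu>2 (p2 \<theta> \<theta>' \<omega>1))) / 2"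

end

theory Submission
  imports Defs
begin

text \<open>
  Both chains move from \<open>\<theta>\<close> to \<open>\<theta>'\<close> with a symmetric flow. Writing \<open>A\<close> and \<open>B\<close> for the densities
  \<open>\<pi> p1 q\<close> of the forward and backward move, the flow of the Metropolis-within-Gibbs chain is
  \<open>\<integral> min A B\<close> and that of the auxiliary chain is \<open>\<integral>\<integral> min (A p2) (B p2')\<close>. As \<open>p2\<close> and \<open>p2'\<close>
  integrate to \<open>1\<close>, the latter is at most the former, and at least \<open>c\<close> times the former as soon as
  \<open>\<integral> min p2 p2' \<ge> c\<close>; this overlap is bounded below in terms of the total variation distance
  and of the Kullback-Leibler divergence. The comparison of flows is a two-sided comparison of
  Dirichlet forms, which bounds the numerical radius, hence the norm, of the self-adjoint operator
  of the auxiliary chain.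
\<close>

section \<open>Overlap of probability densities\<close>

text \<open>The law of a rejected move has no tractable form. It only concerns pairs
  \<open>(x, x)\<close>, however, where \<open>(f x - f y)\<^sup>2\<close> vanishes, so Dirichlet
  forms depend on the flows alone and a pointwise comparison of flows suffices. The
  Metropolis-within-Gibbs chain is not analysed separately: it is the auxiliary chain whose second
  auxiliary variable lives on a one-point space. The factor \<open>exp (- 1 / exp 1)\<close> is the
  price of a sign. The overlap is the mean under \<open>f\<close> of
  \<open>exp (- L\<^sup>+)\<close>, where \<open>L = ln (f/g)\<close>, whereas the divergence is the
  mean of \<open>L\<close> itself, in which negative values of \<open>L\<close> are credited. The
  mean of the negative part is at most \<open>1 / exp 1\<close>, so the mean of
  \<open>L\<^sup>+\<close> exceeds the divergence by no more than that. Both overlap bounds are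
  needed at every single \<open>\<omega>1\<close>, because \<open>A\<close> and \<open>B\<close>
  depend on \<open>\<omega>1\<close>; this is why the distances take a supremum over it.\<close>

lemma integrable_probability_density:
  assumes "f \<in> borel_measurable M" "\<And>x. x \<in> space M \<Longrightarrow> 0 \<le> f x" "prob_space (rdensity M f)"
  shows "integrable M f" and "integral\<^sup>L M f = 1"
proof -
  have "(\<integral>\<^sup>+x. ennreal (f x) \<partial>M) = ennreal 1"
    using prob_space.emeasure_space_1[OF assms(3)] assms(1)
    by (simp add: emeasure_density cong: nn_integral_cong)
  then have "has_bochner_integral M f 1"
    using assms by (intro has_bochner_integral_nn_integral) auto
  then show "integrable M f" "integral\<^sup>L M f = 1"
    by (auto simp: has_bochner_integral_iff)
qed

lemma abs_measure_diff_le_1: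
  assumes "prob_space P" "prob_space Q"
  shows "\<bar>measure P A - measure Q A\<bar> \<le> 1"
  using prob_space.prob_le_1[OF assms(1), of A] prob_space.prob_le_1[OF assms(2), of A]
    measure_nonneg[of P A] measure_nonneg[of Q A] by linarith

lemma dTV_upper:
  assumes "prob_space P" "prob_space Q" "A \<in> sets P"
  shows "\<bar>measure P A - measure Q A\<bar> \<le> dTV P Q"
  unfolding dTV_def
proof (rule cSUP_upper[OF assms(3)])
  show "bdd_above ((\<lambda>A. \<bar>measure P A - measure Q A\<bar>) ` sets P)"
    using abs_measure_diff_le_1[OF assms(1,2)] by (intro bdd_aboveI[of _ 1]) auto
qed

lemma dTV_bounds:
  assumes "prob_space P" "prob_space Q"
  shows "0 \<le> dTV P Q" "dTV P Q \<le> 1"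
proof -
  show "0 \<le> dTV P Q"
    using dTV_upper[OF assms, of "{}"] by simp
  show "dTV P Q \<le> 1"
    unfolding dTV_def using abs_measure_diff_le_1[OF assms] by (intro cSUP_least) auto
qed

lemma measure_rdensity:
  assumes "f \<in> borel_measurable M" "\<And>x. x \<in> space M \<Longrightarrow> 0 \<le> f x" "integrable M f" "A \<in> sets M"
  shows "measure (rdensity M f) A = (\<integral>x. f x * indicator A x \<partial>M)"
proof -
  have "emeasure (rdensity M f) A = (\<integral>\<^sup>+x. ennreal (f x * indicator A x) \<partial>M)"
    using assms by (subst emeasure_density) (auto intro!: nn_integral_cong split: split_indicator)
  also have "\<dots> = ennreal (\<integral>x. f x * indicator A x \<partial>M)"
    using assms by (intro nn_integral_eq_integral integrable_real_mult_indicator) auto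
  finally show ?thesis
    using assms by (simp add: measure_def integral_nonneg_AE)
qed

text \<open>The set where \<open>g < f\<close> is the witness: on it \<open>f - g\<close> equals
  \<open>f - min f g\<close>, and off it \<open>f - min f g\<close> is zero, so the two measures of
  this set differ by exactly 1 minus the overlap.\<close>

lemma overlap_ge_dTV:
  assumes f: "f \<in> borel_measurable M" "\<And>x. x \<in> space M \<Longrightarrow> 0 \<le> f x" "prob_space (rdensity M f)"
    and g: "g \<in> borel_measurable M" "\<And>x. x \<in> space M \<Longrightarrow> 0 \<le> g x" "prob_space (rdensity M g)"
  shows "1 - dTV (rdensity M f) (rdensity M g) \<le> (\<integral>x. min (f x) (g x) \<partial>M)"
proof -
  note [measurable] = f(1) g(1)
  note intf = integrable_probability_density[OF f] and intg = integrable_probability_density[OF g]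
  define A where "A = {x \<in> space M. g x < f x}"
  have A[measurable]: "A \<in> sets M" unfolding A_def by measurable
  have "measure (rdensity M f) A - measure (rdensity M g) A
      = (\<integral>x. f x * indicator A x - g x * indicator A x \<partial>M)"
    using intf intg f g
    by (simp add: measure_rdensity integrable_real_mult_indicator Bochner_Integration.integral_diff)
  also have "\<dots> = (\<integral>x. f x - min (f x) (g x) \<partial>M)"
    by (intro Bochner_Integration.integral_cong) (auto simp: A_def split: split_indicator)
  also have "\<dots> = 1 - (\<integral>x. min (f x) (g x) \<partial>M)"
    using intf intg by simp
  finally show ?thesis
    using dTV_upper[OF f(3) g(3), of A] by simp
qed

text \<open>The tangent line of \<open>ln\<close> at \<open>exp 1\<close>, the one through the
  origin. Applied to \<open>g / f\<close> it bounds \<open>- ln (f/g)\<close> by a function whose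
  mean under \<open>f\<close> is at most \<open>1 / exp 1\<close>.\<close>

lemma ln_le_divide_exp:
  assumes "0 < (z::real)"
  shows "ln z \<le> z / exp 1"
  using ln_le_minus_one[of "z / exp 1"] assms by (simp add: ln_div)

text \<open>
  With \<open>L = ln (f/g)\<close> and \<open>m = - KL - 1/e\<close>, the bound \<open>ln z \<le> z/e\<close> gives
  \<open>L\<^sup>+ \<le> L + g/(e f)\<close>, and the tangent line of \<open>exp\<close> at \<open>m\<close> replaces Jensen's inequality:
  \<open>min f g = f exp (- L\<^sup>+) \<ge> e\<^sup>m (f (1 - L - m) - g/e)\<close>.
\<close>
lemma overlap_ge_dKL:
  assumes f: "f \<in> borel_measurable M" "\<And>x. x \<in> space M \<Longrightarrow> 0 \<le> f x" "prob_space (rdensity M f)"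
    and g: "g \<in> borel_measurable M" "\<And>x. x \<in> space M \<Longrightarrow> 0 \<le> g x" "prob_space (rdensity M g)"
    and M: "sigma_finite_measure M"
  shows "exp (- 1 / exp 1) * exp_minus (dKL (rdensity M f) (rdensity M g))
    \<le> (\<integral>x. min (f x) (g x) \<partial>M)"
proof (cases "dKL (rdensity M f) (rdensity M g) = \<infinity>")
  case True
  then show ?thesis
    using f g by (auto simp: exp_minus_def intro!: integral_nonneg_AE AE_I2)
next
  case False
  note [measurable] = f(1) g(1)
  let ?P = "rdensity M f" and ?Q = "rdensity M g"
  interpret sigma_finite_measure M by fact
  interpret Q: prob_space ?Q by fact
  note intf = integrable_probability_density[OF f] and intg = integrable_probability_density[OF g]
  define KL where "KL = KL_divergence (exp 1) ?Q ?P"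
  from False have ac: "absolutely_continuous ?Q ?P"
    and int: "integrable ?P (entropy_density (exp 1) ?Q ?P)"
    and dKL: "dKL ?P ?Q = ennreal KL"
    by (auto simp: dKL_def KL_def split: if_splits)
  have null: "{x \<in> space M. g x = 0} \<in> null_sets ?Q"
    by (subst null_sets_density_iff) auto
  have ac': "AE x in M. g x = 0 \<longrightarrow> f x = 0"
  proof -
    have "{x \<in> space M. g x = 0} \<in> null_sets ?P"
      using ac null by (auto simp: absolutely_continuous_def)
    then have "AE x in M. x \<in> {x \<in> space M. g x = 0} \<longrightarrow> ennreal (f x) = 0"
      by (subst (asm) null_sets_density_iff) auto
    with AE_space show ?thesis
      by eventually_elim (use f(2) in \<open>fastforce simp: ennreal_eq_0_iff intro: antisym\<close>)
  qed
  \<comment> \<open>\<open>f / g\<close> is a density of \<open>?P\<close> with respect to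
    \<open>?Q\<close>, so uniqueness identifies it with the derivative inside
    \<open>entropy_density\<close>. This holds \<open>?Q\<close>-almost everywhere, that is, only
    where \<open>g\<close> is positive; elsewhere \<open>ac'\<close> makes the factor
    \<open>f\<close> vanish.\<close>
  have dd: "density ?Q (\<lambda>x. ennreal (f x / g x)) = ?P"
    using f g ac' by (subst density_density_divide) auto
  have "AE x in ?Q. ennreal (f x / g x) = RN_deriv ?Q ?P x"
    using dd by (intro Q.RN_deriv_unique) auto
  then have rn: "AE x in M. 0 < g x \<longrightarrow> RN_deriv ?Q ?P x = ennreal (f x / g x)"
    by (subst (asm) AE_density) auto
  define L where "L x = ln (f x / g x)" for x
  have eq: "AE x in M. f x * entropy_density (exp 1) ?Q ?P x = f x * L x"
    using rn ac' AE_space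
  proof eventually_elim
    case (elim x)
    then show ?case
      using f(2)[of x] g(2)[of x]
      by (cases "g x = 0") (auto simp: entropy_density_def L_def log_def less_le)
  qed
  have [measurable]: "entropy_density (exp 1) ?Q ?P \<in> borel_measurable M"
    using measurable_entropy_density[of "exp 1" ?Q ?P] by simp
  have [measurable]: "L \<in> borel_measurable M" unfolding L_def by measurable
  have "integrable M (\<lambda>x. f x * entropy_density (exp 1) ?Q ?P x)"
    using int f by (subst (asm) integrable_real_density) auto
  then have intL: "integrable M (\<lambda>x. f x * L x)"
    by (subst (asm) integrable_cong_AE[OF _ _ eq]) auto
  have "KL = (\<integral>x. f x * entropy_density (exp 1) ?Q ?P x \<partial>M)"
    unfolding KL_def KL_divergence_def using f by (subst integral_real_density) auto
  also have "\<dots> = (\<integral>x. f x * L x \<partial>M)"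
    by (intro integral_cong_AE eq) auto
  finally have KL: "(\<integral>x. f x * L x \<partial>M) = KL" by simp
  \<comment> \<open>With this tangent point, \<open>(1 - m) - KL - 1 / exp 1 = 1\<close>, so the
    integral of the left side of \<open>pw\<close> is exactly \<open>exp m\<close>.\<close>
  define m where "m = - KL - 1 / exp 1"
  have pw: "AE x in M. exp m * (f x * (1 - m) - f x * L x - g x / exp 1) \<le> min (f x) (g x)"
    using ac' AE_space
  proof eventually_elim
    case (elim x)
    consider "f x = 0" | "0 < f x" "0 < g x"
      using f(2)[of x] g(2)[of x] elim by (auto simp: less_le)
    then show ?case
    proof cases
      case 1
      with g(2)[of x] elim show ?thesis by (simp add: mult_nonneg_nonneg)
    next
      case 2
      define t where "t = max 0 (L x)"
      have "- L x \<le> (g x / f x) / exp 1"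
        using ln_le_divide_exp[of "g x / f x"] 2 by (simp add: L_def ln_div)
      then have "t \<le> L x + (g x / f x) / exp 1"
        using 2 by (auto simp: t_def)
      then have "f x * t \<le> f x * (L x + (g x / f x) / exp 1)"
        using 2 by (intro mult_left_mono) auto
      then have ft: "f x * t \<le> f x * L x + g x / exp 1"
        using 2 by (simp add: distrib_left)
      have "exp m * (1 - t - m) \<le> exp m * exp (- t - m)"
        using exp_ge_add_one_self[of "- t - m"] by (intro mult_left_mono) (auto simp: algebra_simps)
      also have "\<dots> = exp (- t)" by (simp flip: exp_add)
      finally have "f x * (exp m * (1 - t - m)) \<le> f x * exp (- t)"
        using 2 by (intro mult_left_mono) auto
      also have "f x * exp (- t) = min (f x) (g x)"
      proof (cases "f x \<le> g x")
        case True
        then have "L x \<le> 0" using 2 by (simp add: L_def)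
        then show ?thesis using True by (simp add: t_def)
      next
        case False
        then have "0 \<le> L x" using 2 by (simp add: L_def)
        then show ?thesis using False 2 by (simp add: t_def L_def exp_minus)
      qed
      finally have "exp m * (f x * (1 - m) - f x * t) \<le> min (f x) (g x)"
        by (simp add: algebra_simps)
      moreover have "exp m * (f x * (1 - m) - f x * L x - g x / exp 1)
          \<le> exp m * (f x * (1 - m) - f x * t)"
        using ft by (intro mult_left_mono) auto
      ultimately show ?thesis by linarith
    qed
  qed
  have "exp m = exp m * ((1 - m) - KL - 1 / exp 1)" by (simp add: m_def)
  also have "\<dots> = (\<integral>x. exp m * (f x * (1 - m) - f x * L x - g x / exp 1) \<partial>M)"
    using intf intg intL KL by simp
  also have "\<dots> \<le> (\<integral>x. min (f x) (g x) \<partial>M)"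
    using intf intg intL pw by (intro integral_mono_AE) auto
  finally have "exp m \<le> (\<integral>x. min (f x) (g x) \<partial>M)" .
  \<comment> \<open>Both signs of \<open>KL\<close> are covered: \<open>ennreal\<close> truncates a
    negative value to 0, the left side becomes \<open>exp (- 1 / exp 1)\<close>, and this is still
    at most \<open>exp m\<close>.\<close>
  moreover have "exp (- 1 / exp 1) * exp_minus (dKL ?P ?Q) \<le> exp m"
    by (cases "0 \<le> KL") (auto simp: dKL exp_minus_def m_def ennreal_neg simp flip: exp_add)
  ultimately show ?thesis by linarith
qed

lemma exp_minus_antimono: "x \<le> y \<Longrightarrow> exp_minus y \<le> exp_minus x"
  by (auto simp: exp_minus_def top_unique less_top intro!: enn2real_mono)

lemma exp_minus_bounds: "0 \<le> exp_minus x" "exp_minus x \<le> 1"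
  by (auto simp: exp_minus_def)

text \<open>This brings the symmetrized divergence within reach of the one-sided bound
  \<open>overlap_ge_dKL\<close>: at each \<open>\<omega>1\<close> the average dominates the smaller
  of the two directed divergences.\<close>

lemma min_le_half_sum_ennreal: "min a b \<le> (a + b) / 2" for a b :: ennreal
proof -
  have "min a b = (min a b + min a b) / 2"
    using ennreal_mult_divide_eq[of 2 "min a b"] by (simp add: mult_2_right)
  also have "\<dots> \<le> (a + b) / 2"
    by (intro divide_right_mono_ennreal add_mono) auto
  finally show ?thesis .
qed

section \<open>Spectral gaps of reversible kernels\<close>

lemma kernel_integral_measurable:
  fixes f :: "'b \<Rightarrow> real"
  assumes [measurable]: "f \<in> borel_measurable B" and N[measurable]: "N \<in> M \<rightarrow>\<^sub>M subprob_algebra B"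
  shows "(\<lambda>x. \<integral>y. f y \<partial>N x) \<in> borel_measurable M"
proof -
  have m: "f \<in> borel_measurable (N x)" if "x \<in> space M" for x
    using that sets_kernel[OF N that] by simp
  have [measurable]: "(\<lambda>x. \<integral>\<^sup>+y. h y \<partial>N x) \<in> borel_measurable M" if "h \<in> borel_measurable B" for h
    by (rule nn_integral_measurable_subprob_algebra[OF that, THEN measurable_compose[OF N]])
  \<comment> \<open>The case split reproduces the convention that the integral of a non-integrable
    function is 0, so the two functions agree at every \<open>x\<close>.\<close>
  have "(\<lambda>x. if (\<integral>\<^sup>+y. ennreal \<bar>f y\<bar> \<partial>N x) < \<infinity>
      then enn2real (\<integral>\<^sup>+y. ennreal (f y) \<partial>N x) - enn2real (\<integral>\<^sup>+y. ennreal (- f y) \<partial>N x)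
      else 0) \<in> borel_measurable M"
    by measurable
  then show ?thesis
    by (rule measurable_cong[THEN iffD1, rotated])
      (auto simp: real_lebesgue_integral_def integrable_iff_bounded m not_integrable_integral_eq)
qed

text \<open>The signed counterpart of \<open>nn_integral_bind\<close>, applied to the positive and
  the negative part separately. Their total integrals are finite, hence both are finite for almost
  every \<open>x\<close> and the difference is well defined there.\<close>

lemma integral_bind_integrable:
  fixes f :: "'b \<Rightarrow> real"
  assumes N[measurable]: "N \<in> M \<rightarrow>\<^sub>M subprob_algebra B" and int: "integrable (M \<bind> N) f"
    and f[measurable]: "f \<in> borel_measurable B"
  shows "AE x in M. integrable (N x) f"
    and "integrable M (\<lambda>x. \<integral>y. f y \<partial>N x)"
    and "(\<integral>y. f y \<partial>(M \<bind> N)) = (\<integral>x. \<integral>y. f y \<partial>N x \<partial>M)"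
proof -
  have m: "f \<in> borel_measurable (N x)" if "x \<in> space M" for x
    using that sets_kernel[OF N that] by simp
  have [measurable]: "(\<lambda>x. \<integral>\<^sup>+y. h y \<partial>N x) \<in> borel_measurable M" if "h \<in> borel_measurable B" for h
    by (rule nn_integral_measurable_subprob_algebra[OF that, THEN measurable_compose[OF N]])
  \<comment> \<open>As \<open>ennreal\<close> truncates at 0, \<open>F 1 x\<close> and
    \<open>F (-1) x\<close> are the integrals of the positive and the negative part of
    \<open>f\<close>.\<close>
  define F where "F s x = (\<integral>\<^sup>+y. ennreal (s * f y) \<partial>N x)" for s x
  have [measurable]: "F s \<in> borel_measurable M" for s unfolding F_def by measurable
  have bind: "(\<integral>\<^sup>+y. ennreal (s * f y) \<partial>(M \<bind> N)) = (\<integral>\<^sup>+x. F s x \<partial>M)" for s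
    unfolding F_def by (intro nn_integral_bind[OF _ N]) simp
  have fin: "(\<integral>\<^sup>+x. F s x \<partial>M) < \<infinity>" for s
  proof -
    have "(\<integral>\<^sup>+y. ennreal (s * f y) \<partial>(M \<bind> N)) \<le> (\<integral>\<^sup>+y. ennreal (norm (s * f y)) \<partial>(M \<bind> N))"
      by (intro nn_integral_mono ennreal_leI) auto
    also have "\<dots> < \<infinity>"
      using integrable_mult_right[OF int, of s] unfolding integrable_iff_bounded by blast
    finally show ?thesis by (simp add: bind)
  qed
  have fin': "AE x in M. F s x < \<infinity>" for s
    using nn_integral_PInf_AE[of "F s" M] fin[of s] by (auto simp: less_top)
  have F: "AE x in M. integrable (N x) f \<and> (\<integral>y. f y \<partial>N x) = enn2real (F 1 x) - enn2real (F (-1) x)"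
    using fin'[of 1] fin'[of "-1"] AE_space
  proof eventually_elim
    case (elim x)
    have "(\<integral>\<^sup>+y. ennreal (norm (f y)) \<partial>N x) = (\<integral>\<^sup>+y. ennreal (1 * f y) + ennreal (-1 * f y) \<partial>N x)"
      by (intro nn_integral_cong) (simp add: abs_if ennreal_neg)
    also have "\<dots> = F 1 x + F (-1) x"
      unfolding F_def using elim m[of x] by (intro nn_integral_add) auto
    finally have "integrable (N x) f"
      using elim m[of x] by (auto simp: integrable_iff_bounded)
    then show ?case by (auto simp: real_lebesgue_integral_def F_def)
  qed
  then show "AE x in M. integrable (N x) f" by auto
  have i: "integrable M (\<lambda>x. enn2real (F s x))"
    and ii: "(\<integral>x. enn2real (F s x) \<partial>M) = enn2real (\<integral>\<^sup>+x. F s x \<partial>M)" for s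
  proof -
    have "(\<integral>\<^sup>+x. ennreal (enn2real (F s x)) \<partial>M) = (\<integral>\<^sup>+x. F s x \<partial>M)"
      using fin'[of s] by (intro nn_integral_cong_AE) (auto elim!: eventually_mono simp: less_top)
    then show "integrable M (\<lambda>x. enn2real (F s x))"
      "(\<integral>x. enn2real (F s x) \<partial>M) = enn2real (\<integral>\<^sup>+x. F s x \<partial>M)"
      using fin[of s] by (auto simp: integrable_iff_bounded integral_eq_nn_integral)
  qed
  have [measurable]: "(\<lambda>x. \<integral>y. f y \<partial>N x) \<in> borel_measurable M"
    by (rule kernel_integral_measurable[OF f N])
  have ae: "AE x in M. enn2real (F 1 x) - enn2real (F (-1) x) = (\<integral>y. f y \<partial>N x)"
    using F by auto
  show "integrable M (\<lambda>x. \<integral>y. f y \<partial>N x)"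
    by (rule integrable_cong_AE[THEN iffD1, OF _ _ ae]) (auto simp: i)
  have "(\<integral>x. \<integral>y. f y \<partial>N x \<partial>M) = (\<integral>x. enn2real (F 1 x) - enn2real (F (-1) x) \<partial>M)"
    by (rule integral_cong_AE) (use F in auto)
  also have "\<dots> = (\<integral>y. f y \<partial>(M \<bind> N))"
    using bind[of 1] bind[of "-1"] int by (simp add: i ii real_lebesgue_integral_def)
  finally show "(\<integral>y. f y \<partial>(M \<bind> N)) = (\<integral>x. \<integral>y. f y \<partial>N x \<partial>M)" by simp
qed

section \<open>Square-integrable functions\<close>

lemma abs_mult_le_sum_squares: "\<bar>a * b\<bar> \<le> a\<^sup>2 + b\<^sup>2" for a b :: real
proof -
  have "2 * \<bar>a * b\<bar> \<le> a\<^sup>2 + b\<^sup>2"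
    using sum_squares_bound[of "\<bar>a\<bar>" "\<bar>b\<bar>"] by (simp add: abs_mult)
  then show ?thesis by linarith
qed

lemma integrable_product_L2:
  fixes f g :: "'a \<Rightarrow> real"
  assumes [measurable]: "f \<in> borel_measurable M" "g \<in> borel_measurable M"
    and "integrable M (\<lambda>x. (f x)\<^sup>2)" "integrable M (\<lambda>x. (g x)\<^sup>2)"
  shows "integrable M (\<lambda>x. f x * g x)"
proof (rule Bochner_Integration.integrable_bound)
  show "integrable M (\<lambda>x. (f x)\<^sup>2 + (g x)\<^sup>2)"
    using assms by simp
  show "AE x in M. norm (f x * g x) \<le> norm ((f x)\<^sup>2 + (g x)\<^sup>2)"
    by (simp add: abs_mult_le_sum_squares)
qed measurable

lemma Cauchy_Schwarz_L2_norm: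
  assumes f: "f \<in> borel_measurable M" "integrable M (\<lambda>x. (f x)\<^sup>2)"
    and g: "g \<in> borel_measurable M" "integrable M (\<lambda>x. (g x)\<^sup>2)"
  shows "\<bar>\<integral>x. f x * g x \<partial>M\<bar> \<le> L2_norm M f * L2_norm M g"
proof -
  note fg = integrable_product_L2[OF f(1) g(1) f(2) g(2)]
  have sq: "(\<integral>\<^sup>+x. ennreal ((h x)\<^sup>2) \<partial>M) = ennreal ((L2_norm M h)\<^sup>2)"
    if "integrable M (\<lambda>x. (h x)\<^sup>2)" for h
    using nn_integral_eq_integral[OF that]
    by (simp add: L2_norm_def integral_nonneg_AE)
  have "(\<integral>\<^sup>+x. ennreal \<bar>f x\<bar> * ennreal \<bar>g x\<bar> \<partial>M) = ennreal (\<integral>x. \<bar>f x * g x\<bar> \<partial>M)"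
    using nn_integral_eq_integral[OF integrable_abs[OF fg]]
    by (simp add: abs_mult flip: ennreal_mult)
  then have "ennreal ((\<integral>x. \<bar>f x * g x\<bar> \<partial>M)\<^sup>2) \<le> ennreal ((L2_norm M f * L2_norm M g)\<^sup>2)"
    using Cauchy_Schwarz_nn_integral[of "\<lambda>x. ennreal \<bar>f x\<bar>" M "\<lambda>x. ennreal \<bar>g x\<bar>"] f g
    by (simp add: sq ennreal_power integral_nonneg_AE power_mult_distrib flip: ennreal_mult)
  then have "(\<integral>x. \<bar>f x * g x\<bar> \<partial>M) \<le> L2_norm M f * L2_norm M g"
    using power2_le_imp_le[of "\<integral>x. \<bar>f x * g x\<bar> \<partial>M" "L2_norm M f * L2_norm M g"]
    by (simp add: L2_norm_def integral_nonneg_AE)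
  then show ?thesis
    using integral_abs_bound[of M "\<lambda>x. f x * g x"] by linarith
qed

section \<open>Reversible kernels and the law of two consecutive states\<close>

text \<open>Detailed balance is stated through nonnegative functions on pairs, which needs no
  integrability. Stationarity of \<open>\<nu>\<close> is the case of an \<open>h\<close> that
  depends on one coordinate.\<close>

locale reversible_kernel = prob_space \<nu> for \<nu> :: "'a measure" +
  fixes K :: "'a \<Rightarrow> 'a measure"
  assumes kernel[measurable]: "K \<in> \<nu> \<rightarrow>\<^sub>M prob_algebra \<nu>"
    and reversible: "\<And>h. h \<in> borel_measurable (\<nu> \<Otimes>\<^sub>M \<nu>) \<Longrightarrow>
      (\<integral>\<^sup>+x. \<integral>\<^sup>+y. h (x, y) \<partial>K x \<partial>\<nu>) = (\<integral>\<^sup>+x. \<integral>\<^sup>+y. h (y, x) \<partial>K x \<partial>\<nu>)"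
begin

text \<open>The law of two consecutive states of the stationary chain. Both marginals are
  \<open>\<nu>\<close> and the measure is symmetric, which turns statements about the operator of
  \<open>K\<close> into statements about integrals over one measure.\<close>

definition joint :: "('a \<times> 'a) measure" where
  "joint = \<nu> \<bind> (\<lambda>x. distr (K x) (\<nu> \<Otimes>\<^sub>M \<nu>) (Pair x))"

lemma kernel_prob: "x \<in> space \<nu> \<Longrightarrow> prob_space (K x)"
  and kernel_sets: "x \<in> space \<nu> \<Longrightarrow> sets (K x) = sets \<nu>"
  using measurable_space[OF kernel] by (auto simp: space_prob_algebra)

lemma kernel_subprob[measurable]: "K \<in> \<nu> \<rightarrow>\<^sub>M subprob_algebra \<nu>"
  by (rule measurable_prob_algebraD[OF kernel])

lemma joint_kernel[measurable]:
  "(\<lambda>x. distr (K x) (\<nu> \<Otimes>\<^sub>M \<nu>) (Pair x)) \<in> \<nu> \<rightarrow>\<^sub>M prob_algebra (\<nu> \<Otimes>\<^sub>M \<nu>)"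
  by (intro measurable_distr_prob_space2[where M=\<nu>]) auto

lemmas joint_kernel_subprob = measurable_prob_algebraD[OF joint_kernel]

lemma in_prob_algebra: "\<nu> \<in> space (prob_algebra \<nu>)"
  by (simp add: space_prob_algebra prob_space_axioms)

lemma sets_joint[measurable_cong, simp]: "sets joint = sets (\<nu> \<Otimes>\<^sub>M \<nu>)"
  unfolding joint_def by (rule sets_bind'[OF in_prob_algebra joint_kernel])

lemma nn_integral_joint:
  assumes [measurable]: "h \<in> borel_measurable (\<nu> \<Otimes>\<^sub>M \<nu>)"
  shows "(\<integral>\<^sup>+z. h z \<partial>joint) = (\<integral>\<^sup>+x. \<integral>\<^sup>+y. h (x, y) \<partial>K x \<partial>\<nu>)"
  unfolding joint_def
proof (subst nn_integral_bind[OF assms joint_kernel_subprob], intro nn_integral_cong)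
  fix x assume x: "x \<in> space \<nu>"
  then show "(\<integral>\<^sup>+z. h z \<partial>distr (K x) (\<nu> \<Otimes>\<^sub>M \<nu>) (Pair x)) = (\<integral>\<^sup>+y. h (x, y) \<partial>K x)"
    using kernel_sets[OF x] by (subst nn_integral_distr) (auto cong: measurable_cong_sets)
qed

lemma integral_joint:
  fixes h :: "'a \<times> 'a \<Rightarrow> real"
  assumes int: "integrable joint h"
  shows "AE x in \<nu>. integrable (K x) (\<lambda>y. h (x, y))"
    and "integrable \<nu> (\<lambda>x. \<integral>y. h (x, y) \<partial>K x)"
    and "(\<integral>z. h z \<partial>joint) = (\<integral>x. \<integral>y. h (x, y) \<partial>K x \<partial>\<nu>)"
proof -
  have h[measurable]: "h \<in> borel_measurable (\<nu> \<Otimes>\<^sub>M \<nu>)"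
    using borel_measurable_integrable[OF int] by simp
  have P: "Pair x \<in> K x \<rightarrow>\<^sub>M \<nu> \<Otimes>\<^sub>M \<nu>" if "x \<in> space \<nu>" for x
    using that kernel_sets[OF that] by (auto cong: measurable_cong_sets)
  have eq: "(\<integral>z. h z \<partial>distr (K x) (\<nu> \<Otimes>\<^sub>M \<nu>) (Pair x)) = (\<integral>y. h (x, y) \<partial>K x)" if "x \<in> space \<nu>" for x
    by (rule integral_distr[OF P[OF that] h])
  note b = integral_bind_integrable[OF joint_kernel_subprob int[unfolded joint_def] h]
  show "AE x in \<nu>. integrable (K x) (\<lambda>y. h (x, y))"
    using b(1) AE_space by eventually_elim (simp add: integrable_distr_eq[OF P h])
  show "integrable \<nu> (\<lambda>x. \<integral>y. h (x, y) \<partial>K x)"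
    using b(2) by (simp add: eq cong: Bochner_Integration.integrable_cong)
  show "(\<integral>z. h z \<partial>joint) = (\<integral>x. \<integral>y. h (x, y) \<partial>K x \<partial>\<nu>)"
    using b(3) unfolding joint_def[symmetric] by (simp add: eq cong: Bochner_Integration.integral_cong)
qed

lemma nn_integral_joint_fst:
  assumes [measurable]: "g \<in> borel_measurable \<nu>"
  shows "(\<integral>\<^sup>+z. g (fst z) \<partial>joint) = (\<integral>\<^sup>+x. g x \<partial>\<nu>)"
  by (subst nn_integral_joint)
    (auto intro!: nn_integral_cong simp: prob_space.emeasure_space_1[OF kernel_prob])

text \<open>This is stationarity: reversibility moves the variable to the first coordinate, and the
  inner integral is then that of a constant over a probability measure.\<close>

lemma nn_integral_joint_snd:
  assumes [measurable]: "g \<in> borel_measurable \<nu>"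
  shows "(\<integral>\<^sup>+z. g (snd z) \<partial>joint) = (\<integral>\<^sup>+x. g x \<partial>\<nu>)"
proof -
  have "(\<integral>\<^sup>+z. g (snd z) \<partial>joint) = (\<integral>\<^sup>+x. \<integral>\<^sup>+y. g (snd (x, y)) \<partial>K x \<partial>\<nu>)"
    by (rule nn_integral_joint) measurable
  also have "\<dots> = (\<integral>\<^sup>+x. \<integral>\<^sup>+y. g (snd (y, x)) \<partial>K x \<partial>\<nu>)"
    by (rule reversible[of "\<lambda>z. g (snd z)"]) measurable
  also have "\<dots> = (\<integral>\<^sup>+x. g x \<partial>\<nu>)"
    by (auto intro!: nn_integral_cong simp: prob_space.emeasure_space_1[OF kernel_prob])
  finally show ?thesis .
qed

text \<open>As equations between measures, the marginals and the symmetry become available to signed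
  integrals by change of variables.\<close>

lemma distr_joint:
  "distr joint \<nu> fst = \<nu>" "distr joint \<nu> snd = \<nu>" "distr joint (\<nu> \<Otimes>\<^sub>M \<nu>) prod.swap = joint"
proof -
  have "emeasure (distr joint \<nu> fst) A = emeasure \<nu> A"
    if [measurable]: "A \<in> sets \<nu>" for A
    using nn_integral_joint_fst[of "indicator A"]
    by (simp add: nn_integral_indicator[symmetric] nn_integral_distr del: nn_integral_indicator)
  then show "distr joint \<nu> fst = \<nu>" by (intro measure_eqI) auto
  have "emeasure (distr joint \<nu> snd) A = emeasure \<nu> A"
    if [measurable]: "A \<in> sets \<nu>" for A
    using nn_integral_joint_snd[of "indicator A"]
    by (simp add: nn_integral_indicator[symmetric] nn_integral_distr del: nn_integral_indicator)
  then show "distr joint \<nu> snd = \<nu>" by (intro measure_eqI) auto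
  have sw[measurable]: "prod.swap \<in> \<nu> \<Otimes>\<^sub>M \<nu> \<rightarrow>\<^sub>M \<nu> \<Otimes>\<^sub>M \<nu>"
    unfolding prod.swap_def by measurable
  have "emeasure (distr joint (\<nu> \<Otimes>\<^sub>M \<nu>) prod.swap) A = emeasure joint A"
    if [measurable]: "A \<in> sets (\<nu> \<Otimes>\<^sub>M \<nu>)" for A
  proof -
    have "emeasure (distr joint (\<nu> \<Otimes>\<^sub>M \<nu>) prod.swap) A = (\<integral>\<^sup>+z. indicator A (prod.swap z) \<partial>joint)"
      by (simp add: nn_integral_indicator[symmetric] nn_integral_distr del: nn_integral_indicator)
    also have "\<dots> = (\<integral>\<^sup>+x. \<integral>\<^sup>+y. indicator A (y, x) \<partial>K x \<partial>\<nu>)"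
      by (subst nn_integral_joint) auto
    also have "\<dots> = (\<integral>\<^sup>+z. indicator A z \<partial>joint)"
      by (subst nn_integral_joint) (auto intro!: reversible[symmetric])
    finally show ?thesis by simp
  qed
  then show "distr joint (\<nu> \<Otimes>\<^sub>M \<nu>) prod.swap = joint" by (intro measure_eqI) auto
qed

lemma integral_joint_fst:
  fixes g :: "'a \<Rightarrow> real"
  assumes [measurable]: "g \<in> borel_measurable \<nu>"
  shows "integrable joint (\<lambda>z. g (fst z)) \<longleftrightarrow> integrable \<nu> g"
    and "(\<integral>z. g (fst z) \<partial>joint) = (\<integral>x. g x \<partial>\<nu>)"
  using integrable_distr_eq[of fst joint \<nu> g] integral_distr[of fst joint \<nu> g]
  by (simp_all add: distr_joint)

lemma integral_joint_snd:
  fixes g :: "'a \<Rightarrow> real"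
  assumes [measurable]: "g \<in> borel_measurable \<nu>"
  shows "integrable joint (\<lambda>z. g (snd z)) \<longleftrightarrow> integrable \<nu> g"
    and "(\<integral>z. g (snd z) \<partial>joint) = (\<integral>x. g x \<partial>\<nu>)"
  using integrable_distr_eq[of snd joint \<nu> g] integral_distr[of snd joint \<nu> g]
  by (simp_all add: distr_joint)


section \<open>The bilinear form of a reversible kernel\<close>

text \<open>The inner product of \<open>f\<close> with \<open>kernel_op K g\<close> in L2 of
  \<open>\<nu>\<close>. Written over \<open>joint\<close>, its symmetry is just the exchange of
  coordinates.\<close>

definition form :: "('a \<Rightarrow> real) \<Rightarrow> ('a \<Rightarrow> real) \<Rightarrow> real" where
  "form f g = (\<integral>z. f (fst z) * g (snd z) \<partial>joint)"

lemma integrable_form: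
  fixes f g :: "'a \<Rightarrow> real"
  assumes [measurable]: "f \<in> borel_measurable \<nu>" "g \<in> borel_measurable \<nu>"
    and "integrable \<nu> (\<lambda>x. (f x)\<^sup>2)" "integrable \<nu> (\<lambda>x. (g x)\<^sup>2)"
  shows "integrable joint (\<lambda>z. f (fst z) * g (snd z))"
proof (rule Bochner_Integration.integrable_bound)
  show "integrable joint (\<lambda>z. (f (fst z))\<^sup>2 + (g (snd z))\<^sup>2)"
    using assms integral_joint_fst(1)[of "\<lambda>x. (f x)\<^sup>2"] integral_joint_snd(1)[of "\<lambda>x. (g x)\<^sup>2"]
    by (intro Bochner_Integration.integrable_add) auto
  show "AE z in joint. norm (f (fst z) * g (snd z)) \<le> norm ((f (fst z))\<^sup>2 + (g (snd z))\<^sup>2)"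
    by (simp add: abs_mult_le_sum_squares)
qed measurable

lemma form_sym:
  assumes [measurable]: "f \<in> borel_measurable \<nu>" "g \<in> borel_measurable \<nu>"
  shows "form f g = form g f"
proof -
  have [measurable]: "prod.swap \<in> \<nu> \<Otimes>\<^sub>M \<nu> \<rightarrow>\<^sub>M \<nu> \<Otimes>\<^sub>M \<nu>"
    unfolding prod.swap_def by measurable
  have "form f g = (\<integral>z. f (fst z) * g (snd z) \<partial>distr joint (\<nu> \<Otimes>\<^sub>M \<nu>) prod.swap)"
    by (simp add: form_def distr_joint)
  also have "\<dots> = form g f"
    unfolding form_def by (subst integral_distr) (auto simp: mult.commute)
  finally show ?thesis .
qed

lemma form_combination:
  fixes f g :: "'a \<Rightarrow> real"
  assumes [measurable]: "f \<in> borel_measurable \<nu>" "g \<in> borel_measurable \<nu>"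
    and i: "integrable \<nu> (\<lambda>x. (f x)\<^sup>2)" "integrable \<nu> (\<lambda>x. (g x)\<^sup>2)"
  shows "form (\<lambda>x. a * f x + b * g x) (\<lambda>x. a * f x + b * g x)
    = a\<^sup>2 * form f f + 2 * a * b * form f g + b\<^sup>2 * form g g"
proof -
  note ff = integrable_form[OF assms(1,1) i(1,1)] and fg = integrable_form[OF assms(1,2) i]
    and gf = integrable_form[OF assms(2,1) i(2,1)] and gg = integrable_form[OF assms(2,2) i(2,2)]
  have "form (\<lambda>x. a * f x + b * g x) (\<lambda>x. a * f x + b * g x)
    = (\<integral>z. a\<^sup>2 * (f (fst z) * f (snd z)) + a * b * (f (fst z) * g (snd z))
        + a * b * (g (fst z) * f (snd z)) + b\<^sup>2 * (g (fst z) * g (snd z)) \<partial>joint)"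
    unfolding form_def
    by (intro Bochner_Integration.integral_cong) (auto simp: algebra_simps power2_eq_square)
  also have "\<dots> = a\<^sup>2 * form f f + a * b * form f g + a * b * form g f + b\<^sup>2 * form g g"
    using ff fg gf gg by (simp add: form_def)
  finally show ?thesis
    using form_sym[OF assms(1,2)] by simp
qed

lemma form_kernel_op:
  assumes [measurable]: "f \<in> borel_measurable \<nu>" "g \<in> borel_measurable \<nu>"
    and i: "integrable \<nu> (\<lambda>x. (f x)\<^sup>2)" "integrable \<nu> (\<lambda>x. (g x)\<^sup>2)"
  shows "form f g = (\<integral>x. f x * kernel_op K g x \<partial>\<nu>)"
  unfolding form_def kernel_op_def by (subst integral_joint(3)[OF integrable_form[OF assms]]) simp

text \<open>Jensen's inequality for the square, in the form that the variance of \<open>f\<close>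
  under \<open>K x\<close> is nonnegative. Integrated over \<open>\<nu>\<close>, stationarity turns
  it into the contraction property.\<close>

lemma kernel_op_square_le:
  assumes [measurable]: "f \<in> borel_measurable \<nu>" and i: "integrable \<nu> (\<lambda>x. (f x)\<^sup>2)"
  shows "kernel_op K f \<in> borel_measurable \<nu>"
    and "integrable \<nu> (\<lambda>x. (kernel_op K f x)\<^sup>2)"
    and "(\<integral>x. (kernel_op K f x)\<^sup>2 \<partial>\<nu>) \<le> (\<integral>x. (f x)\<^sup>2 \<partial>\<nu>)"
    and "(\<integral>x. kernel_op K f x \<partial>\<nu>) = (\<integral>x. f x \<partial>\<nu>)"
proof -
  show m[measurable]: "kernel_op K f \<in> borel_measurable \<nu>"
    using kernel_integral_measurable[of f \<nu> K \<nu>] by (simp add: kernel_op_def[abs_def])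
  have if1: "integrable joint (\<lambda>z. f (snd z))"
    using integral_joint_snd(1)[of f] square_integrable_imp_integrable[OF assms] by simp
  have if2: "integrable joint (\<lambda>z. (f (snd z))\<^sup>2)"
    using integral_joint_snd(1)[of "\<lambda>x. (f x)\<^sup>2"] i by simp
  have ae: "AE x in \<nu>. (kernel_op K f x)\<^sup>2 \<le> (\<integral>y. (f y)\<^sup>2 \<partial>K x)"
    using integral_joint(1)[OF if1] integral_joint(1)[OF if2] AE_space
  proof eventually_elim
    case (elim x)
    interpret K: prob_space "K x" using kernel_prob elim by auto
    show ?case
      using K.variance_eq[of f] K.variance_positive[of f] elim(1,2) unfolding kernel_op_def snd_conv
      by linarith
  qed
  have j: "integrable \<nu> (\<lambda>x. \<integral>y. (f y)\<^sup>2 \<partial>K x)"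
    using integral_joint(2)[OF if2] by simp
  show k: "integrable \<nu> (\<lambda>x. (kernel_op K f x)\<^sup>2)"
    by (rule Bochner_Integration.integrable_bound[OF j]) (use ae in \<open>auto elim!: eventually_mono\<close>)
  have "(\<integral>x. (kernel_op K f x)\<^sup>2 \<partial>\<nu>) \<le> (\<integral>x. \<integral>y. (f y)\<^sup>2 \<partial>K x \<partial>\<nu>)"
    by (rule integral_mono_AE[OF k j ae])
  also have "\<dots> = (\<integral>x. (f x)\<^sup>2 \<partial>\<nu>)"
    using integral_joint(3)[OF if2] integral_joint_snd(2)[of "\<lambda>x. (f x)\<^sup>2"] by simp
  finally show "(\<integral>x. (kernel_op K f x)\<^sup>2 \<partial>\<nu>) \<le> (\<integral>x. (f x)\<^sup>2 \<partial>\<nu>)" .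
  show "(\<integral>x. kernel_op K f x \<partial>\<nu>) = (\<integral>x. f x \<partial>\<nu>)"
    using integral_joint(3)[OF if1] integral_joint_snd(2)[of f] by (simp add: kernel_op_def)
qed

section \<open>Operator norm, numerical radius and Dirichlet form\<close>

lemma kernel_op_L2_0: "f \<in> L2_0 \<nu> \<Longrightarrow> kernel_op K f \<in> L2_0 \<nu>"
  using kernel_op_square_le[of f] by (auto simp: L2_0_def)

lemma L2_norm_kernel_op_le_L2_norm: "f \<in> L2_0 \<nu> \<Longrightarrow> L2_norm \<nu> (kernel_op K f) \<le> L2_norm \<nu> f"
  using kernel_op_square_le[of f] by (auto simp: L2_0_def L2_norm_def)

text \<open>Contraction bounds the defining set by 1, so its real supremum is a genuine one. The
  step from unit vectors to all \<open>f\<close> is scaling; at norm 0, where no scaling is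
  possible, contraction already gives the bound.\<close>

lemma op_norm_nonneg: "0 \<le> op_norm_L2_0 \<nu> K"
  and op_norm_le_1: "op_norm_L2_0 \<nu> K \<le> 1"
  and L2_norm_kernel_op_le: "f \<in> L2_0 \<nu> \<Longrightarrow> L2_norm \<nu> (kernel_op K f) \<le> op_norm_L2_0 \<nu> K * L2_norm \<nu> f"
proof -
  let ?S = "insert 0 {L2_norm \<nu> (kernel_op K f) | f. f \<in> L2_0 \<nu> \<and> L2_norm \<nu> f = 1}"
  have S: "s \<le> 1" if "s \<in> ?S" for s
    using that L2_norm_kernel_op_le_L2_norm by fastforce
  then have bdd: "bdd_above ?S" by (auto simp: bdd_above_def)
  show "0 \<le> op_norm_L2_0 \<nu> K" unfolding op_norm_L2_0_def by (rule cSup_upper[OF _ bdd]) simp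
  show "op_norm_L2_0 \<nu> K \<le> 1" unfolding op_norm_L2_0_def by (rule cSup_least[OF _ S]) auto
  show "L2_norm \<nu> (kernel_op K f) \<le> op_norm_L2_0 \<nu> K * L2_norm \<nu> f" if f: "f \<in> L2_0 \<nu>"
  proof (cases "L2_norm \<nu> f = 0")
    case True
    with L2_norm_kernel_op_le_L2_norm[OF f] show ?thesis by simp
  next
    case False
    define n where "n = L2_norm \<nu> f"
    with False have n: "0 < n" by (simp add: L2_norm_def less_le integral_nonneg_AE)
    have scale: "L2_norm \<nu> (\<lambda>x. g x / n) = L2_norm \<nu> g / n" for g
      using n by (simp add: L2_norm_def power_divide real_sqrt_divide)
    have "(\<lambda>x. f x / n) \<in> L2_0 \<nu>" "L2_norm \<nu> (\<lambda>x. f x / n) = 1"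
      using f n scale[of f] by (auto simp: L2_0_def power_divide n_def)
    then have "L2_norm \<nu> (kernel_op K (\<lambda>x. f x / n)) \<le> op_norm_L2_0 \<nu> K"
      unfolding op_norm_L2_0_def by (intro cSup_upper[OF _ bdd]) auto
    also have "kernel_op K (\<lambda>x. f x / n) = (\<lambda>x. kernel_op K f x / n)"
      by (auto simp: kernel_op_def)
    finally show ?thesis
      using n by (simp add: scale n_def[symmetric] field_simps)
  qed
qed

lemma form_le_op_norm:
  assumes f: "f \<in> L2_0 \<nu>"
  shows "\<bar>form f f\<bar> \<le> op_norm_L2_0 \<nu> K * (\<integral>x. (f x)\<^sup>2 \<partial>\<nu>)"
proof -
  have f': "f \<in> borel_measurable \<nu>" "integrable \<nu> (\<lambda>x. (f x)\<^sup>2)"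
    using f by (auto simp: L2_0_def)
  have k: "kernel_op K f \<in> borel_measurable \<nu>" "integrable \<nu> (\<lambda>x. (kernel_op K f x)\<^sup>2)"
    using kernel_op_L2_0[OF f] by (auto simp: L2_0_def)
  have "\<bar>form f f\<bar> \<le> L2_norm \<nu> f * L2_norm \<nu> (kernel_op K f)"
    unfolding form_kernel_op[OF f'(1,1) f'(2,2)] by (rule Cauchy_Schwarz_L2_norm[OF f' k])
  also have "\<dots> \<le> L2_norm \<nu> f * (op_norm_L2_0 \<nu> K * L2_norm \<nu> f)"
    by (intro mult_left_mono L2_norm_kernel_op_le f) (simp add: L2_norm_def integral_nonneg_AE)
  also have "\<dots> = op_norm_L2_0 \<nu> K * (\<integral>x. (f x)\<^sup>2 \<partial>\<nu>)"
    by (simp add: L2_norm_def integral_nonneg_AE mult.left_commute)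
  finally show ?thesis .
qed

text \<open>
  A self-adjoint operator is bounded by its numerical radius: for \<open>u = K f\<close> of norm \<open>n\<close>, polarize
  \<open>n\<^sup>2 = form u f\<close> with the vectors \<open>u/n + f\<close> and \<open>u/n - f\<close>.
\<close>
lemma op_norm_le_numerical_radius:
  assumes \<rho>: "0 \<le> \<rho>" and r: "\<And>f. f \<in> L2_0 \<nu> \<Longrightarrow> \<bar>form f f\<bar> \<le> \<rho> * (\<integral>x. (f x)\<^sup>2 \<partial>\<nu>)"
  shows "op_norm_L2_0 \<nu> K \<le> \<rho>"
  unfolding op_norm_L2_0_def
proof (rule cSup_least)
  fix s assume "s \<in> insert 0 {L2_norm \<nu> (kernel_op K f) | f. f \<in> L2_0 \<nu> \<and> L2_norm \<nu> f = 1}"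
  then consider "s = 0" | f where "f \<in> L2_0 \<nu>" "L2_norm \<nu> f = 1" "s = L2_norm \<nu> (kernel_op K f)"
    by auto
  then show "s \<le> \<rho>"
  proof cases
    case (2 f)
    define u where "u = kernel_op K f"
    define n where "n = L2_norm \<nu> u"
    have f: "f \<in> borel_measurable \<nu>" "integrable \<nu> (\<lambda>x. (f x)\<^sup>2)" "integral\<^sup>L \<nu> f = 0"
      using 2 by (auto simp: L2_0_def)
    have u: "u \<in> borel_measurable \<nu>" "integrable \<nu> (\<lambda>x. (u x)\<^sup>2)" "integral\<^sup>L \<nu> u = 0"
      using kernel_op_L2_0[OF 2(1)] by (auto simp: L2_0_def u_def)
    note [measurable] = f(1) u(1)
    have fu: "integrable \<nu> (\<lambda>x. u x * f x)"
      using f u by (intro integrable_product_L2)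
    have f1: "(\<integral>x. (f x)\<^sup>2 \<partial>\<nu>) = 1"
      using 2(2) by (simp add: L2_norm_def)
    have n2: "(\<integral>x. (u x)\<^sup>2 \<partial>\<nu>) = n\<^sup>2" and n0: "0 \<le> n"
      by (simp_all add: n_def L2_norm_def integral_nonneg_AE)
    show ?thesis
    proof (cases "n = 0")
      case False
      with n0 have n: "0 < n" by simp
      \<comment> \<open>Dividing \<open>u\<close> by \<open>n\<close> makes both summands unit
        vectors: the squared norms of \<open>w 1\<close> and \<open>w (-1)\<close> then add up to 4
        whatever the inner product of \<open>u\<close> and \<open>f\<close>, while their forms
        differ by \<open>4 * n\<close>.\<close>
      define w where "w b x = (1 / n) * u x + b * f x" for b x
      have sq: "(w b x)\<^sup>2 = (1 / n)\<^sup>2 * (u x)\<^sup>2 + (2 * b / n) * (u x * f x) + b\<^sup>2 * (f x)\<^sup>2" for b x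
        by (simp add: w_def power2_eq_square algebra_simps add_divide_distrib)
      have w: "w b \<in> L2_0 \<nu>" for b
        unfolding L2_0_def mem_Collect_eq sq
        using f u fu square_integrable_imp_integrable[OF f(1,2)] square_integrable_imp_integrable[OF u(1,2)]
        by (auto simp: w_def[abs_def])
      have wn: "(\<integral>x. (w b x)\<^sup>2 \<partial>\<nu>) = 1 + (2 * b / n) * (\<integral>x. u x * f x \<partial>\<nu>) + b\<^sup>2" for b
        unfolding sq using f u fu n by (simp add: f1 n2 power_divide)
      have wf: "form (w b) (w b) = (1 / n)\<^sup>2 * form u u + 2 * (1 / n) * b * form u f + b\<^sup>2 * form f f" for b
        unfolding w_def[abs_def] by (rule form_combination[OF u(1) f(1) u(2) f(2)])
      have "form u f = n\<^sup>2"
        using form_kernel_op[OF u(1) f(1) u(2) f(2)] n2 by (simp add: u_def power2_eq_square)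
      then have "4 * n = form (w 1) (w 1) - form (w (-1)) (w (-1))"
        using n unfolding wf by (simp add: power2_eq_square)
      also have "\<dots> \<le> \<rho> * (\<integral>x. (w 1 x)\<^sup>2 \<partial>\<nu>) + \<rho> * (\<integral>x. (w (-1) x)\<^sup>2 \<partial>\<nu>)"
        using r[OF w[of 1]] r[OF w[of "-1"]] by linarith
      also have "\<dots> = 4 * \<rho>"
        unfolding wn by (simp add: algebra_simps)
      finally show ?thesis using 2(3) by (simp add: n_def u_def)
    qed (use 2 \<rho> in \<open>simp add: n_def u_def\<close>)
  qed (use \<rho> in simp)
qed simp

text \<open>The double integral is twice the Dirichlet form, the inner product of \<open>f\<close>
  with \<open>f - kernel_op K f\<close>. The second claim supplies the nonnegativity with which
  \<open>ennreal\<close> can be removed when two such values are compared.\<close>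

lemma dirichlet_form:
  assumes [measurable]: "f \<in> borel_measurable \<nu>" and i: "integrable \<nu> (\<lambda>x. (f x)\<^sup>2)"
  shows "(\<integral>\<^sup>+x. \<integral>\<^sup>+y. ennreal ((f x - f y)\<^sup>2) \<partial>K x \<partial>\<nu>) = ennreal (2 * (\<integral>x. (f x)\<^sup>2 \<partial>\<nu>) - 2 * form f f)"
    and "form f f \<le> (\<integral>x. (f x)\<^sup>2 \<partial>\<nu>)"
proof -
  have i1: "integrable joint (\<lambda>z. (f (fst z))\<^sup>2)" and i2: "integrable joint (\<lambda>z. (f (snd z))\<^sup>2)"
    using integral_joint_fst(1)[of "\<lambda>x. (f x)\<^sup>2"] integral_joint_snd(1)[of "\<lambda>x. (f x)\<^sup>2"] i by auto
  note i3 = integrable_form[OF assms(1,1) i i]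
  have eq: "(f a - f b)\<^sup>2 = (f a)\<^sup>2 + (f b)\<^sup>2 - 2 * (f a * f b)" for a b
    by (simp add: power2_diff)
  have int: "integrable joint (\<lambda>z. (f (fst z) - f (snd z))\<^sup>2)"
    unfolding eq using i1 i2 i3 by simp
  have val: "(\<integral>z. (f (fst z) - f (snd z))\<^sup>2 \<partial>joint) = 2 * (\<integral>x. (f x)\<^sup>2 \<partial>\<nu>) - 2 * form f f"
    unfolding eq form_def using i1 i2 i3
      integral_joint_fst(2)[of "\<lambda>x. (f x)\<^sup>2"] integral_joint_snd(2)[of "\<lambda>x. (f x)\<^sup>2"] by simp
  have "(\<integral>\<^sup>+x. \<integral>\<^sup>+y. ennreal ((f x - f y)\<^sup>2) \<partial>K x \<partial>\<nu>) = (\<integral>\<^sup>+z. ennreal ((f (fst z) - f (snd z))\<^sup>2) \<partial>joint)"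
    by (subst nn_integral_joint) auto
  also have "\<dots> = ennreal (\<integral>z. (f (fst z) - f (snd z))\<^sup>2 \<partial>joint)"
    by (intro nn_integral_eq_integral int) auto
  finally show "(\<integral>\<^sup>+x. \<integral>\<^sup>+y. ennreal ((f x - f y)\<^sup>2) \<partial>K x \<partial>\<nu>)
    = ennreal (2 * (\<integral>x. (f x)\<^sup>2 \<partial>\<nu>) - 2 * form f f)" by (simp add: val)
  have "0 \<le> (\<integral>z. (f (fst z) - f (snd z))\<^sup>2 \<partial>joint)" by (intro integral_nonneg_AE) simp
  then show "form f f \<le> (\<integral>x. (f x)\<^sup>2 \<partial>\<nu>)" by (simp add: val)
qed

end

text \<open>
  \<^const>\<open>Gap\<close> is the absolute spectral gap, so both ends of the spectrum have to be controlled: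
  the lower bound on the Dirichlet form of \<open>K2\<close> controls the upper end, and the upper bound on it
  says that \<open>K2 - K1\<close> is positive, which controls the lower end.
\<close>
lemma Gap_comparison:
  assumes K1: "reversible_kernel \<nu> K1" and K2: "reversible_kernel \<nu> K2" and c: "0 \<le> c" "c \<le> 1"
    and lower: "\<And>f. f \<in> borel_measurable \<nu> \<Longrightarrow>
      ennreal c * (\<integral>\<^sup>+x. \<integral>\<^sup>+y. ennreal ((f x - f y)\<^sup>2) \<partial>K1 x \<partial>\<nu>)
        \<le> (\<integral>\<^sup>+x. \<integral>\<^sup>+y. ennreal ((f x - f y)\<^sup>2) \<partial>K2 x \<partial>\<nu>)"
    and upper: "\<And>f. f \<in> borel_measurable \<nu> \<Longrightarrow>
      (\<integral>\<^sup>+x. \<integral>\<^sup>+y. ennreal ((f x - f y)\<^sup>2) \<partial>K2 x \<partial>\<nu>)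
        \<le> (\<integral>\<^sup>+x. \<integral>\<^sup>+y. ennreal ((f x - f y)\<^sup>2) \<partial>K1 x \<partial>\<nu>)"
  shows "c * Gap \<nu> K1 \<le> Gap \<nu> K2"
proof -
  interpret K1: reversible_kernel \<nu> K1 by fact
  interpret K2: reversible_kernel \<nu> K2 by fact
  let ?n = "op_norm_L2_0 \<nu> K1"
  have n: "0 \<le> ?n" "?n \<le> 1" by (rule K1.op_norm_nonneg K1.op_norm_le_1)+
  \<comment> \<open>Chosen so that \<open>1 - \<rho>\<close> is \<open>c * Gap \<nu> K1\<close>.
    Since \<open>c \<le> 1\<close>, it also dominates the norm of \<open>K1\<close>, which the lower
    end of the spectrum requires.\<close>
  define \<rho> where "\<rho> = 1 - c * (1 - ?n)"
  have "c * (1 - ?n) \<le> 1 * (1 - ?n)" using c n by (intro mult_right_mono) auto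
  then have n\<rho>: "?n \<le> \<rho>" by (simp add: \<rho>_def)
  have "op_norm_L2_0 \<nu> K2 \<le> \<rho>"
  proof (rule K2.op_norm_le_numerical_radius)
    show "0 \<le> \<rho>" using n n\<rho> by simp
    fix f assume f: "f \<in> L2_0 \<nu>"
    then have f': "f \<in> borel_measurable \<nu>" "integrable \<nu> (\<lambda>x. (f x)\<^sup>2)" by (auto simp: L2_0_def)
    define S where "S = (\<integral>x. (f x)\<^sup>2 \<partial>\<nu>)"
    have S: "0 \<le> S" by (simp add: S_def integral_nonneg_AE)
    note d1 = K1.dirichlet_form[OF f', folded S_def] and d2 = K2.dirichlet_form[OF f', folded S_def]
    have "c * (2 * S - 2 * K1.form f f) \<le> 2 * S - 2 * K2.form f f"
      using lower[OF f'(1)] d1(2) d2(2) c by (simp add: d1(1) d2(1) flip: ennreal_mult)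
    then have up: "K2.form f f \<le> S - c * (S - K1.form f f)" by (simp add: algebra_simps)
    have lo: "K1.form f f \<le> K2.form f f"
      using upper[OF f'(1)] d1(2) d2(2) by (simp add: d1(1) d2(1))
    have b: "\<bar>K1.form f f\<bar> \<le> ?n * S" using K1.form_le_op_norm[OF f] by (simp add: S_def)
    have "c * K1.form f f \<le> c * (?n * S)" using b c by (intro mult_left_mono) auto
    with up have "K2.form f f \<le> \<rho> * S" by (simp add: \<rho>_def algebra_simps)
    moreover have "?n * S \<le> \<rho> * S" using n\<rho> S by (rule mult_right_mono)
    ultimately show "\<bar>K2.form f f\<bar> \<le> \<rho> * (\<integral>x. (f x)\<^sup>2 \<partial>\<nu>)"
      using b lo unfolding S_def[symmetric] by linarith
  qed
  then show ?thesis by (simp add: Gap_def \<rho>_def)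
qed

section \<open>Flows of the two chains\<close>

lemma rdensity_kernel:
  assumes N: "sigma_finite_measure N" and [measurable]: "(\<lambda>(x, y). f x y) \<in> borel_measurable (M \<Otimes>\<^sub>M N)"
    and "\<And>x. x \<in> space M \<Longrightarrow> prob_space (rdensity N (f x))"
  shows "(\<lambda>x. rdensity N (f x)) \<in> M \<rightarrow>\<^sub>M prob_algebra N"
proof (intro measurable_prob_algebraI measurable_subprob_algebra assms(3) prob_space_imp_subprob_space)
  interpret sigma_finite_measure N by fact
  fix A assume [measurable]: "A \<in> sets N"
  have "(\<lambda>x. \<integral>\<^sup>+y. ennreal (f x y) * indicator A y \<partial>N) \<in> borel_measurable M"
    by measurable
  then show "(\<lambda>x. emeasure (rdensity N (f x)) A) \<in> borel_measurable M"
    by (rule measurable_cong[THEN iffD1, rotated]) (simp add: emeasure_density)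
qed auto

lemma accept_prob_bounds:
  assumes "0 \<le> a" "0 \<le> b"
  shows "0 \<le> accept_prob a b" "accept_prob a b \<le> 1"
  using assms by (auto simp: accept_prob_def)

lemma accept_prob_measurable[measurable (raw)]:
  assumes [measurable]: "f \<in> borel_measurable M" "g \<in> borel_measurable M"
  shows "(\<lambda>x. accept_prob (f x) (g x)) \<in> borel_measurable M"
  unfolding accept_prob_def by measurable

text \<open>The identity behind Metropolis-Hastings: proposed mass times acceptance probability is
  symmetric in the two directions. At \<open>b = 0\<close> both sides vanish because
  \<open>a\<close> is nonnegative.\<close>

lemma mult_accept_prob:
  assumes "0 \<le> a" "0 \<le> b"
  shows "b * accept_prob a b = min b a"
  using assms by (auto simp: accept_prob_def min_def field_simps)

lemma nn_integral_accept_step: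
  assumes "0 \<le> a" "a \<le> 1" "x \<in> space M" "y \<in> space M" "g \<in> borel_measurable M"
  shows "(\<integral>\<^sup>+z. g z \<partial>accept_step M a x y) = ennreal a * g y + ennreal (1 - a) * g x"
  unfolding accept_step_def using assms
  by (subst nn_integral_distr) (auto simp: mult.commute)

lemma prob_space_accept_step: "x \<in> space M \<Longrightarrow> y \<in> space M \<Longrightarrow> prob_space (accept_step M a x y)"
  unfolding accept_step_def by (intro measure_pmf.prob_space_distr) auto

lemma accept_step_kernel:
  assumes [measurable]: "a \<in> borel_measurable N" "f \<in> N \<rightarrow>\<^sub>M M" "g \<in> N \<rightarrow>\<^sub>M M"
    and a: "\<And>x. x \<in> space N \<Longrightarrow> 0 \<le> a x" "\<And>x. x \<in> space N \<Longrightarrow> a x \<le> 1"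
  shows "(\<lambda>x. accept_step M (a x) (f x) (g x)) \<in> N \<rightarrow>\<^sub>M prob_algebra M"
proof (intro measurable_prob_algebraI measurable_subprob_algebra prob_space_accept_step prob_space_imp_subprob_space)
  fix A assume [measurable]: "A \<in> sets M"
  have "(\<lambda>x. ennreal (a x) * indicator A (g x) + ennreal (1 - a x) * indicator A (f x)) \<in> borel_measurable N"
    by measurable
  then show "(\<lambda>x. emeasure (accept_step M (a x) (f x) (g x)) A) \<in> borel_measurable N"
  proof (rule measurable_cong[THEN iffD1, rotated])
    fix x assume x: "x \<in> space N"
    then have "f x \<in> space M" "g x \<in> space M" by (auto intro: measurable_space)
    then show "ennreal (a x) * indicator A (g x) + ennreal (1 - a x) * indicator A (f x)
      = emeasure (accept_step M (a x) (f x) (g x)) A"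
      using nn_integral_accept_step[of "a x" "f x" M "g x" "indicator A"] a[OF x]
      by (simp add: nn_integral_indicator accept_step_def)
  qed
qed (auto simp: accept_step_def intro: measurable_space)

section \<open>The auxiliary chain as a Markov kernel\<close>

context aux_mcmc
begin

lemma measurable_target'[measurable (raw)]:
  "f \<in> M \<rightarrow>\<^sub>M \<mu> \<Longrightarrow> (\<lambda>x. \<pi> (f x)) \<in> borel_measurable M"
  by (rule measurable_compose[OF _ measurable_target])

lemma measurable_p1'[measurable (raw)]:
  "\<lbrakk>f \<in> M \<rightarrow>\<^sub>M \<mu>; g \<in> M \<rightarrow>\<^sub>M \<mu>1\<rbrakk> \<Longrightarrow> (\<lambda>x. p1 (f x) (g x)) \<in> borel_measurable M"
  using measurable_compose[OF measurable_Pair measurable_p1, of f M g] by simp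

lemma measurable_q'[measurable (raw)]:
  "\<lbrakk>f \<in> M \<rightarrow>\<^sub>M \<mu>1; g \<in> M \<rightarrow>\<^sub>M \<mu>; h \<in> M \<rightarrow>\<^sub>M \<mu>\<rbrakk> \<Longrightarrow> (\<lambda>x. q (f x) (g x) (h x)) \<in> borel_measurable M"
  using measurable_compose[OF measurable_Pair[OF _ measurable_Pair] measurable_q, of f M g h] by simp

lemma measurable_p2'[measurable (raw)]:
  "\<lbrakk>f \<in> M \<rightarrow>\<^sub>M \<mu>; g \<in> M \<rightarrow>\<^sub>M \<mu>; h \<in> M \<rightarrow>\<^sub>M \<mu>1; k \<in> M \<rightarrow>\<^sub>M \<mu>2\<rbrakk>
    \<Longrightarrow> (\<lambda>x. p2 (f x) (g x) (h x) (k x)) \<in> borel_measurable M"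
  using measurable_compose[OF measurable_Pair[OF _ measurable_Pair[OF _ measurable_Pair]] measurable_p2, of f M g h k]
  by simp

text \<open>The joint density of a stationary state \<open>\<theta>\<close>, both auxiliary
  variables and the proposal \<open>\<theta>'\<close>. Exchanging \<open>\<theta>\<close> and
  \<open>\<theta>'\<close> gives the numerator of the acceptance ratio.\<close>

definition weight where
  "weight \<theta> \<theta>' \<omega>1 \<omega>2 = \<pi> \<theta> * joint_density p1 p2 \<theta> \<theta>' \<omega>1 \<omega>2 * q \<omega>1 \<theta> \<theta>'"

abbreviation acc where
  "acc \<theta> \<theta>' \<omega>1 \<omega>2 \<equiv> accept_prob (weight \<theta>' \<theta> \<omega>1 \<omega>2) (weight \<theta> \<theta>' \<omega>1 \<omega>2)"

abbreviation K where "K \<equiv> P_aux \<mu> \<mu>1 \<mu>2 \<pi> p1 p2 q"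

abbreviation \<nu> where "\<nu> \<equiv> rdensity \<mu> \<pi>"

lemma weight_measurable[measurable (raw)]:
  assumes [measurable]: "f \<in> M \<rightarrow>\<^sub>M \<mu>" "g \<in> M \<rightarrow>\<^sub>M \<mu>" "h \<in> M \<rightarrow>\<^sub>M \<mu>1" "k \<in> M \<rightarrow>\<^sub>M \<mu>2"
  shows "(\<lambda>x. weight (f x) (g x) (h x) (k x)) \<in> borel_measurable M"
  unfolding weight_def joint_density_def by measurable

lemma weight_nonneg:
  "\<lbrakk>\<theta> \<in> space \<mu>; \<theta>' \<in> space \<mu>; \<omega>1 \<in> space \<mu>1; \<omega>2 \<in> space \<mu>2\<rbrakk> \<Longrightarrow> 0 \<le> weight \<theta> \<theta>' \<omega>1 \<omega>2"
  unfolding weight_def joint_density_def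
  by (intro mult_nonneg_nonneg nonneg_target nonneg_p1 nonneg_p2 nonneg_q)

lemma kernel_parts:
  shows p1_kernel: "f \<in> M \<rightarrow>\<^sub>M \<mu> \<Longrightarrow> (\<lambda>x. rdensity \<mu>1 (p1 (f x))) \<in> M \<rightarrow>\<^sub>M prob_algebra \<mu>1"
    and q_kernel: "\<lbrakk>h \<in> M \<rightarrow>\<^sub>M \<mu>1; f \<in> M \<rightarrow>\<^sub>M \<mu>\<rbrakk>
      \<Longrightarrow> (\<lambda>x. rdensity \<mu> (q (h x) (f x))) \<in> M \<rightarrow>\<^sub>M prob_algebra \<mu>"
    and p2_kernel: "\<lbrakk>f \<in> M \<rightarrow>\<^sub>M \<mu>; g \<in> M \<rightarrow>\<^sub>M \<mu>; h \<in> M \<rightarrow>\<^sub>M \<mu>1\<rbrakk>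
      \<Longrightarrow> (\<lambda>x. rdensity \<mu>2 (p2 (f x) (g x) (h x))) \<in> M \<rightarrow>\<^sub>M prob_algebra \<mu>2"
  by (rule rdensity_kernel; use sigma_finite in \<open>auto intro: prob_p1 prob_q prob_p2 measurable_space\<close>)+

lemma step_kernel:
  assumes [measurable]: "f \<in> M \<rightarrow>\<^sub>M \<mu>" "g \<in> M \<rightarrow>\<^sub>M \<mu>" "h \<in> M \<rightarrow>\<^sub>M \<mu>1" "k \<in> M \<rightarrow>\<^sub>M \<mu>2"
  shows "(\<lambda>x. accept_step \<mu> (acc (f x) (g x) (h x) (k x)) (f x) (g x)) \<in> M \<rightarrow>\<^sub>M prob_algebra \<mu>"
  by (intro accept_step_kernel)
    (auto intro!: accept_prob_bounds weight_nonneg intro: measurable_space[OF assms(1)]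
       measurable_space[OF assms(2)] measurable_space[OF assms(3)] measurable_space[OF assms(4)])

text \<open>The nested binds of \<open>P_aux\<close> are cut into named kernels so that
  measurability and integration can be handled one bind at a time.\<close>

definition K_given_proposal where
  "K_given_proposal \<theta> \<omega>1 \<theta>' = rdensity \<mu>2 (p2 \<theta> \<theta>' \<omega>1) \<bind> (\<lambda>\<omega>2. accept_step \<mu> (acc \<theta> \<theta>' \<omega>1 \<omega>2) \<theta> \<theta>')"

definition K_given_aux where
  "K_given_aux \<theta> \<omega>1 = rdensity \<mu> (q \<omega>1 \<theta>) \<bind> K_given_proposal \<theta> \<omega>1"

lemma K_eq: "K \<theta> = rdensity \<mu>1 (p1 \<theta>) \<bind> K_given_aux \<theta>"
  unfolding P_aux_def K_given_aux_def K_given_proposal_def weight_def ..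

lemma K_given_proposal_kernel:
  assumes [measurable]: "f \<in> M \<rightarrow>\<^sub>M \<mu>" "g \<in> M \<rightarrow>\<^sub>M \<mu>" "h \<in> M \<rightarrow>\<^sub>M \<mu>1"
  shows "(\<lambda>x. K_given_proposal (f x) (h x) (g x)) \<in> M \<rightarrow>\<^sub>M prob_algebra \<mu>"
  unfolding K_given_proposal_def
  by (rule measurable_bind_prob_space2[OF p2_kernel]; (unfold case_prod_beta)?; (rule step_kernel)?; measurable)

lemma K_given_aux_kernel:
  assumes [measurable]: "f \<in> M \<rightarrow>\<^sub>M \<mu>" "h \<in> M \<rightarrow>\<^sub>M \<mu>1"
  shows "(\<lambda>x. K_given_aux (f x) (h x)) \<in> M \<rightarrow>\<^sub>M prob_algebra \<mu>"
  unfolding K_given_aux_def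
  by (rule measurable_bind_prob_space2[OF q_kernel]; (unfold case_prod_beta)?; (rule K_given_proposal_kernel)?; measurable)

lemma K_kernel: "K \<in> \<mu> \<rightarrow>\<^sub>M prob_algebra \<mu>"
  unfolding K_eq[abs_def]
  by (rule measurable_bind_prob_space2[OF p1_kernel]; (unfold case_prod_beta)?; (rule K_given_aux_kernel)?; measurable)

lemma nn_integral_K:
  assumes \<theta>: "\<theta> \<in> space \<mu>" and [measurable]: "g \<in> borel_measurable \<mu>"
  shows "(\<integral>\<^sup>+z. g z \<partial>K \<theta>) = (\<integral>\<^sup>+\<omega>1. ennreal (p1 \<theta> \<omega>1) * (\<integral>\<^sup>+\<theta>'. ennreal (q \<omega>1 \<theta> \<theta>') *
    (\<integral>\<^sup>+\<omega>2. ennreal (p2 \<theta> \<theta>' \<omega>1 \<omega>2) *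
      (ennreal (acc \<theta> \<theta>' \<omega>1 \<omega>2) * g \<theta>' + ennreal (1 - acc \<theta> \<theta>' \<omega>1 \<omega>2) * g \<theta>) \<partial>\<mu>2) \<partial>\<mu>) \<partial>\<mu>1)"
proof -
  \<comment> \<open>The fixed point enters as a constant map, so that sections of the jointly
    measurable densities are recognized as measurable; the same device recurs below.\<close>
  note [measurable] = measurable_const[OF \<theta>]
  note nn_integral_measurable_subprob_algebra[measurable]
  have s2[measurable]: "(\<lambda>\<omega>2. accept_step \<mu> (acc \<theta> \<theta>' \<omega>1 \<omega>2) \<theta> \<theta>') \<in> \<mu>2 \<rightarrow>\<^sub>M subprob_algebra \<mu>"
    if "\<omega>1 \<in> space \<mu>1" "\<theta>' \<in> space \<mu>" for \<omega>1 \<theta>'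
    using that \<theta> by (intro measurable_prob_algebraD step_kernel) auto
  have s1[measurable]: "K_given_proposal \<theta> \<omega>1 \<in> \<mu> \<rightarrow>\<^sub>M subprob_algebra \<mu>" if "\<omega>1 \<in> space \<mu>1" for \<omega>1
    using that \<theta> by (intro measurable_prob_algebraD K_given_proposal_kernel) auto
  have s0[measurable]: "K_given_aux \<theta> \<in> \<mu>1 \<rightarrow>\<^sub>M subprob_algebra \<mu>"
    using \<theta> by (intro measurable_prob_algebraD K_given_aux_kernel) auto
  have i2: "(\<integral>\<^sup>+z. g z \<partial>K_given_proposal \<theta> \<omega>1 \<theta>') = (\<integral>\<^sup>+\<omega>2. ennreal (p2 \<theta> \<theta>' \<omega>1 \<omega>2) *
      (ennreal (acc \<theta> \<theta>' \<omega>1 \<omega>2) * g \<theta>' + ennreal (1 - acc \<theta> \<theta>' \<omega>1 \<omega>2) * g \<theta>) \<partial>\<mu>2)"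
    if w: "\<omega>1 \<in> space \<mu>1" "\<theta>' \<in> space \<mu>" for \<omega>1 \<theta>'
  proof -
    note [measurable] = measurable_const[OF w(1)] measurable_const[OF w(2)]
    have "(\<integral>\<^sup>+z. g z \<partial>K_given_proposal \<theta> \<omega>1 \<theta>')
      = (\<integral>\<^sup>+\<omega>2. \<integral>\<^sup>+z. g z \<partial>accept_step \<mu> (acc \<theta> \<theta>' \<omega>1 \<omega>2) \<theta> \<theta>' \<partial>rdensity \<mu>2 (p2 \<theta> \<theta>' \<omega>1))"
      unfolding K_given_proposal_def using s2[OF w] by (intro nn_integral_bind[where B=\<mu>]) auto
    also have "\<dots> = (\<integral>\<^sup>+\<omega>2. ennreal (acc \<theta> \<theta>' \<omega>1 \<omega>2) * g \<theta>' + ennreal (1 - acc \<theta> \<theta>' \<omega>1 \<omega>2) * g \<theta>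
        \<partial>rdensity \<mu>2 (p2 \<theta> \<theta>' \<omega>1))"
      using w \<theta> by (intro nn_integral_cong nn_integral_accept_step accept_prob_bounds weight_nonneg) auto
    also have "\<dots> = (\<integral>\<^sup>+\<omega>2. ennreal (p2 \<theta> \<theta>' \<omega>1 \<omega>2) *
      (ennreal (acc \<theta> \<theta>' \<omega>1 \<omega>2) * g \<theta>' + ennreal (1 - acc \<theta> \<theta>' \<omega>1 \<omega>2) * g \<theta>) \<partial>\<mu>2)"
      by (intro nn_integral_density) measurable
    finally show ?thesis .
  qed
  have i1: "(\<integral>\<^sup>+z. g z \<partial>K_given_aux \<theta> \<omega>1) = (\<integral>\<^sup>+\<theta>'. ennreal (q \<omega>1 \<theta> \<theta>') * (\<integral>\<^sup>+z. g z \<partial>K_given_proposal \<theta> \<omega>1 \<theta>') \<partial>\<mu>)"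
    if w: "\<omega>1 \<in> space \<mu>1" for \<omega>1
  proof -
    note [measurable] = measurable_const[OF w]
    note s1[OF w, measurable]
    have "(\<integral>\<^sup>+z. g z \<partial>K_given_aux \<theta> \<omega>1) = (\<integral>\<^sup>+\<theta>'. \<integral>\<^sup>+z. g z \<partial>K_given_proposal \<theta> \<omega>1 \<theta>' \<partial>rdensity \<mu> (q \<omega>1 \<theta>))"
      unfolding K_given_aux_def by (intro nn_integral_bind[where B=\<mu>]) auto
    also have "\<dots> = (\<integral>\<^sup>+\<theta>'. ennreal (q \<omega>1 \<theta> \<theta>') * (\<integral>\<^sup>+z. g z \<partial>K_given_proposal \<theta> \<omega>1 \<theta>') \<partial>\<mu>)"
      by (intro nn_integral_density) measurable
    finally show ?thesis .
  qed
  have "(\<integral>\<^sup>+z. g z \<partial>K \<theta>) = (\<integral>\<^sup>+\<omega>1. \<integral>\<^sup>+z. g z \<partial>K_given_aux \<theta> \<omega>1 \<partial>rdensity \<mu>1 (p1 \<theta>))"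
    unfolding K_eq by (intro nn_integral_bind[where B=\<mu>]) auto
  also have "\<dots> = (\<integral>\<^sup>+\<omega>1. ennreal (p1 \<theta> \<omega>1) * (\<integral>\<^sup>+z. g z \<partial>K_given_aux \<theta> \<omega>1) \<partial>\<mu>1)"
    by (intro nn_integral_density) measurable
  finally show ?thesis
    by (simp add: i1 i2 cong: nn_integral_cong)
qed

section \<open>Flow decomposition and reversibility\<close>

text \<open>The density with respect to \<open>\<mu> \<Otimes>\<^sub>M \<mu>\<close> of the accepted
  moves of the stationary chain.\<close>

definition flow :: "'a \<Rightarrow> 'a \<Rightarrow> ennreal" where
  "flow \<theta> \<theta>' = (\<integral>\<^sup>+\<omega>1. \<integral>\<^sup>+\<omega>2. ennreal (min (weight \<theta> \<theta>' \<omega>1 \<omega>2) (weight \<theta>' \<theta> \<omega>1 \<omega>2)) \<partial>\<mu>2 \<partial>\<mu>1)"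

text \<open>The density with respect to \<open>\<mu>\<close> of the mass that is held at
  \<open>\<theta>\<close> because its proposal is refused.\<close>

definition rejected :: "'a \<Rightarrow> ennreal" where
  "rejected \<theta> = (\<integral>\<^sup>+\<omega>1. \<integral>\<^sup>+\<theta>'. \<integral>\<^sup>+\<omega>2.
    ennreal (weight \<theta> \<theta>' \<omega>1 \<omega>2 * (1 - acc \<theta> \<theta>' \<omega>1 \<omega>2)) \<partial>\<mu>2 \<partial>\<mu> \<partial>\<mu>1)"

lemma flow_sym: "flow \<theta> \<theta>' = flow \<theta>' \<theta>"
  by (simp add: flow_def min.commute)

sublocale S0: sigma_finite_measure \<mu> + S1: sigma_finite_measure \<mu>1 + S2: sigma_finite_measure \<mu>2
  by (rule sigma_finite)+

lemma flow_measurable[measurable (raw)]: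
  assumes [measurable]: "f \<in> M \<rightarrow>\<^sub>M \<mu>" "g \<in> M \<rightarrow>\<^sub>M \<mu>"
  shows "(\<lambda>x. flow (f x) (g x)) \<in> borel_measurable M"
  unfolding flow_def by measurable

text \<open>The factor \<open>\<pi> \<theta>\<close> completes the product of \<open>p1\<close>,
  \<open>q\<close> and \<open>p2\<close> to \<open>weight\<close>. By
  \<open>mult_accept_prob\<close> the accepted share of it is the symmetric minimum, and the
  remaining share is evaluated at \<open>\<theta>\<close> itself.\<close>

lemma nn_integral_target_K:
  assumes \<theta>: "\<theta> \<in> space \<mu>" and [measurable]: "g \<in> borel_measurable \<mu>"
  shows "ennreal (\<pi> \<theta>) * (\<integral>\<^sup>+z. g z \<partial>K \<theta>) = (\<integral>\<^sup>+\<theta>'. flow \<theta> \<theta>' * g \<theta>' \<partial>\<mu>) + rejected \<theta> * g \<theta>"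
proof -
  note [measurable] = measurable_const[OF \<theta>]
  interpret P: pair_sigma_finite \<mu>1 \<mu> ..
  let ?m = "\<lambda>\<theta>' \<omega>1 \<omega>2. ennreal (min (weight \<theta> \<theta>' \<omega>1 \<omega>2) (weight \<theta>' \<theta> \<omega>1 \<omega>2))"
  let ?r = "\<lambda>\<theta>' \<omega>1 \<omega>2. ennreal (weight \<theta> \<theta>' \<omega>1 \<omega>2 * (1 - acc \<theta> \<theta>' \<omega>1 \<omega>2))"
  let ?i = "\<lambda>\<theta>' \<omega>1 \<omega>2. ennreal (acc \<theta> \<theta>' \<omega>1 \<omega>2) * g \<theta>' + ennreal (1 - acc \<theta> \<theta>' \<omega>1 \<omega>2) * g \<theta>"
  have pw: "ennreal (\<pi> \<theta>) * (ennreal (p1 \<theta> \<omega>1) * (ennreal (q \<omega>1 \<theta> \<theta>') * (ennreal (p2 \<theta> \<theta>' \<omega>1 \<omega>2) * ?i \<theta>' \<omega>1 \<omega>2)))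
    = ?m \<theta>' \<omega>1 \<omega>2 * g \<theta>' + ?r \<theta>' \<omega>1 \<omega>2 * g \<theta>"
    if w: "\<omega>1 \<in> space \<mu>1" "\<theta>' \<in> space \<mu>" "\<omega>2 \<in> space \<mu>2" for \<omega>1 \<theta>' \<omega>2
  proof -
    let ?w = "weight \<theta> \<theta>' \<omega>1 \<omega>2" and ?a = "acc \<theta> \<theta>' \<omega>1 \<omega>2"
    have nn: "0 \<le> \<pi> \<theta>" "0 \<le> p1 \<theta> \<omega>1" "0 \<le> q \<omega>1 \<theta> \<theta>'" "0 \<le> p2 \<theta> \<theta>' \<omega>1 \<omega>2"
      using w \<theta> nonneg_target nonneg_p1 nonneg_q nonneg_p2 by auto
    have W: "0 \<le> ?w" "0 \<le> weight \<theta>' \<theta> \<omega>1 \<omega>2" using w \<theta> weight_nonneg by auto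
    have a: "0 \<le> ?a" "?a \<le> 1" using accept_prob_bounds W by auto
    have "ennreal (\<pi> \<theta>) * (ennreal (p1 \<theta> \<omega>1) * (ennreal (q \<omega>1 \<theta> \<theta>') * (ennreal (p2 \<theta> \<theta>' \<omega>1 \<omega>2) * c)))
      = ennreal ?w * c" for c
      using nn by (simp add: weight_def joint_density_def ennreal_mult mult_ac)
    moreover have "ennreal ?w * ?i \<theta>' \<omega>1 \<omega>2 = ennreal (?w * ?a) * g \<theta>' + ?r \<theta>' \<omega>1 \<omega>2 * g \<theta>"
      using W a by (simp add: ennreal_mult distrib_left mult.assoc)
    ultimately show ?thesis
      using mult_accept_prob[OF W(2,1)] by simp
  qed
  let ?I2 = "\<lambda>\<omega>1 \<theta>'. \<integral>\<^sup>+\<omega>2. ennreal (p2 \<theta> \<theta>' \<omega>1 \<omega>2) * ?i \<theta>' \<omega>1 \<omega>2 \<partial>\<mu>2"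
  let ?M2 = "\<lambda>\<omega>1 \<theta>'. \<integral>\<^sup>+\<omega>2. ?m \<theta>' \<omega>1 \<omega>2 \<partial>\<mu>2" and ?R2 = "\<lambda>\<omega>1 \<theta>'. \<integral>\<^sup>+\<omega>2. ?r \<theta>' \<omega>1 \<omega>2 \<partial>\<mu>2"
  have e2: "ennreal (\<pi> \<theta>) * ennreal (p1 \<theta> \<omega>1) * (ennreal (q \<omega>1 \<theta> \<theta>') * ?I2 \<omega>1 \<theta>')
    = ?M2 \<omega>1 \<theta>' * g \<theta>' + ?R2 \<omega>1 \<theta>' * g \<theta>"
    if w: "\<omega>1 \<in> space \<mu>1" "\<theta>' \<in> space \<mu>" for \<omega>1 \<theta>'
  proof -
    note [measurable] = measurable_const[OF w(1)] measurable_const[OF w(2)]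
    have "ennreal (\<pi> \<theta>) * ennreal (p1 \<theta> \<omega>1) * (ennreal (q \<omega>1 \<theta> \<theta>') * ?I2 \<omega>1 \<theta>')
      = (ennreal (\<pi> \<theta>) * ennreal (p1 \<theta> \<omega>1) * ennreal (q \<omega>1 \<theta> \<theta>')) * ?I2 \<omega>1 \<theta>'"
      by (simp only: mult.assoc)
    also have "\<dots> = (\<integral>\<^sup>+\<omega>2. (ennreal (\<pi> \<theta>) * ennreal (p1 \<theta> \<omega>1) * ennreal (q \<omega>1 \<theta> \<theta>')) *
        (ennreal (p2 \<theta> \<theta>' \<omega>1 \<omega>2) * ?i \<theta>' \<omega>1 \<omega>2) \<partial>\<mu>2)"
      by (rule nn_integral_cmult[symmetric]) measurable
    also have "\<dots> = (\<integral>\<^sup>+\<omega>2. ?m \<theta>' \<omega>1 \<omega>2 * g \<theta>' + ?r \<theta>' \<omega>1 \<omega>2 * g \<theta> \<partial>\<mu>2)"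
      by (intro nn_integral_cong) (simp only: mult.assoc pw[OF w])
    also have "\<dots> = (\<integral>\<^sup>+\<omega>2. ?m \<theta>' \<omega>1 \<omega>2 * g \<theta>' \<partial>\<mu>2) + (\<integral>\<^sup>+\<omega>2. ?r \<theta>' \<omega>1 \<omega>2 * g \<theta> \<partial>\<mu>2)"
      by (rule nn_integral_add) measurable
    also have "(\<integral>\<^sup>+\<omega>2. ?m \<theta>' \<omega>1 \<omega>2 * g \<theta>' \<partial>\<mu>2) = ?M2 \<omega>1 \<theta>' * g \<theta>'"
      by (rule nn_integral_multc) measurable
    also have "(\<integral>\<^sup>+\<omega>2. ?r \<theta>' \<omega>1 \<omega>2 * g \<theta> \<partial>\<mu>2) = ?R2 \<omega>1 \<theta>' * g \<theta>"
      by (rule nn_integral_multc) measurable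
    finally show ?thesis .
  qed
  let ?I1 = "\<lambda>\<omega>1. \<integral>\<^sup>+\<theta>'. ennreal (q \<omega>1 \<theta> \<theta>') * ?I2 \<omega>1 \<theta>' \<partial>\<mu>"
  have e1: "ennreal (\<pi> \<theta>) * (ennreal (p1 \<theta> \<omega>1) * ?I1 \<omega>1)
    = (\<integral>\<^sup>+\<theta>'. ?M2 \<omega>1 \<theta>' * g \<theta>' \<partial>\<mu>) + (\<integral>\<^sup>+\<theta>'. ?R2 \<omega>1 \<theta>' \<partial>\<mu>) * g \<theta>"
    if w: "\<omega>1 \<in> space \<mu>1" for \<omega>1
  proof -
    note [measurable] = measurable_const[OF w]
    have "ennreal (\<pi> \<theta>) * (ennreal (p1 \<theta> \<omega>1) * ?I1 \<omega>1) = (ennreal (\<pi> \<theta>) * ennreal (p1 \<theta> \<omega>1)) * ?I1 \<omega>1"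
      by (simp only: mult.assoc)
    also have "\<dots> = (\<integral>\<^sup>+\<theta>'. ennreal (\<pi> \<theta>) * ennreal (p1 \<theta> \<omega>1) * (ennreal (q \<omega>1 \<theta> \<theta>') * ?I2 \<omega>1 \<theta>') \<partial>\<mu>)"
      by (rule nn_integral_cmult[symmetric]) measurable
    also have "\<dots> = (\<integral>\<^sup>+\<theta>'. ?M2 \<omega>1 \<theta>' * g \<theta>' + ?R2 \<omega>1 \<theta>' * g \<theta> \<partial>\<mu>)"
      by (intro nn_integral_cong e2 w)
    also have "\<dots> = (\<integral>\<^sup>+\<theta>'. ?M2 \<omega>1 \<theta>' * g \<theta>' \<partial>\<mu>) + (\<integral>\<^sup>+\<theta>'. ?R2 \<omega>1 \<theta>' * g \<theta> \<partial>\<mu>)"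
      by (rule nn_integral_add) measurable
    also have "(\<integral>\<^sup>+\<theta>'. ?R2 \<omega>1 \<theta>' * g \<theta> \<partial>\<mu>) = (\<integral>\<^sup>+\<theta>'. ?R2 \<omega>1 \<theta>' \<partial>\<mu>) * g \<theta>"
      by (rule nn_integral_multc) measurable
    finally show ?thesis .
  qed
  have "ennreal (\<pi> \<theta>) * (\<integral>\<^sup>+z. g z \<partial>K \<theta>) = (\<integral>\<^sup>+\<omega>1. ennreal (\<pi> \<theta>) * (ennreal (p1 \<theta> \<omega>1) * ?I1 \<omega>1) \<partial>\<mu>1)"
    unfolding nn_integral_K[OF assms] by (rule nn_integral_cmult[symmetric]) measurable
  also have "\<dots> = (\<integral>\<^sup>+\<omega>1. (\<integral>\<^sup>+\<theta>'. ?M2 \<omega>1 \<theta>' * g \<theta>' \<partial>\<mu>) + (\<integral>\<^sup>+\<theta>'. ?R2 \<omega>1 \<theta>' \<partial>\<mu>) * g \<theta> \<partial>\<mu>1)"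
    by (intro nn_integral_cong e1)
  also have "\<dots> = (\<integral>\<^sup>+\<omega>1. \<integral>\<^sup>+\<theta>'. ?M2 \<omega>1 \<theta>' * g \<theta>' \<partial>\<mu> \<partial>\<mu>1) + (\<integral>\<^sup>+\<omega>1. (\<integral>\<^sup>+\<theta>'. ?R2 \<omega>1 \<theta>' \<partial>\<mu>) * g \<theta> \<partial>\<mu>1)"
    by (rule nn_integral_add) measurable
  also have "(\<integral>\<^sup>+\<omega>1. (\<integral>\<^sup>+\<theta>'. ?R2 \<omega>1 \<theta>' \<partial>\<mu>) * g \<theta> \<partial>\<mu>1) = rejected \<theta> * g \<theta>"
    unfolding rejected_def by (rule nn_integral_multc) measurable
  \<comment> \<open>The proposal law depends on \<open>\<omega>1\<close>, so the chain integrates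
    over \<open>\<theta>'\<close> inside \<open>\<omega>1\<close>; \<open>flow\<close> is a function
    of the two states, so the order has to be exchanged.\<close>
  also have "(\<integral>\<^sup>+\<omega>1. \<integral>\<^sup>+\<theta>'. ?M2 \<omega>1 \<theta>' * g \<theta>' \<partial>\<mu> \<partial>\<mu>1) = (\<integral>\<^sup>+\<theta>'. \<integral>\<^sup>+\<omega>1. ?M2 \<omega>1 \<theta>' * g \<theta>' \<partial>\<mu>1 \<partial>\<mu>)"
    by (rule P.Fubini'[symmetric]) measurable
  also have "\<dots> = (\<integral>\<^sup>+\<theta>'. flow \<theta> \<theta>' * g \<theta>' \<partial>\<mu>)"
  proof (intro nn_integral_cong)
    fix \<theta>' assume "\<theta>' \<in> space \<mu>"
    note [measurable] = measurable_const[OF this]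
    show "(\<integral>\<^sup>+\<omega>1. ?M2 \<omega>1 \<theta>' * g \<theta>' \<partial>\<mu>1) = flow \<theta> \<theta>' * g \<theta>'"
      unfolding flow_def by (rule nn_integral_multc) measurable
  qed
  finally show ?thesis .
qed

text \<open>Two consecutive stationary states have a law made of a part with density
  \<open>flow\<close> and a part on the diagonal. Reversibility and the Dirichlet form are both read
  off from this decomposition.\<close>

lemma nn_integral_chain:
  assumes [measurable]: "h \<in> borel_measurable (\<mu> \<Otimes>\<^sub>M \<mu>)"
  shows "(\<integral>\<^sup>+x. \<integral>\<^sup>+y. h (x, y) \<partial>K x \<partial>\<nu>)
    = (\<integral>\<^sup>+x. \<integral>\<^sup>+y. flow x y * h (x, y) \<partial>\<mu> \<partial>\<mu>) + (\<integral>\<^sup>+x. rejected x * h (x, x) \<partial>\<mu>)"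
proof -
  have [measurable]: "(\<lambda>x. \<integral>\<^sup>+y. h (x, y) \<partial>K x) \<in> borel_measurable \<mu>"
    by (rule nn_integral_measurable_subprob_algebra2[OF _ measurable_prob_algebraD[OF K_kernel]]) measurable
  have [measurable]: "rejected \<in> borel_measurable \<mu>"
    unfolding rejected_def[abs_def] by measurable
  have "(\<integral>\<^sup>+x. \<integral>\<^sup>+y. h (x, y) \<partial>K x \<partial>\<nu>) = (\<integral>\<^sup>+x. ennreal (\<pi> x) * (\<integral>\<^sup>+y. h (x, y) \<partial>K x) \<partial>\<mu>)"
    by (intro nn_integral_density) measurable
  also have "\<dots> = (\<integral>\<^sup>+x. (\<integral>\<^sup>+y. flow x y * h (x, y) \<partial>\<mu>) + rejected x * h (x, x) \<partial>\<mu>)"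
    by (intro nn_integral_cong nn_integral_target_K) measurable
  also have "\<dots> = (\<integral>\<^sup>+x. \<integral>\<^sup>+y. flow x y * h (x, y) \<partial>\<mu> \<partial>\<mu>) + (\<integral>\<^sup>+x. rejected x * h (x, x) \<partial>\<mu>)"
    by (intro nn_integral_add) measurable
  finally show ?thesis .
qed

text \<open>Swapping the coordinates preserves both parts of \<open>nn_integral_chain\<close>:
  \<open>flow\<close> is symmetric, and the diagonal is fixed.\<close>

lemma reversible_K: "reversible_kernel \<nu> K"
proof (intro reversible_kernel.intro reversible_kernel_axioms.intro)
  show "prob_space \<nu>" by (rule prob_target)
  show "K \<in> \<nu> \<rightarrow>\<^sub>M prob_algebra \<nu>"
    using K_kernel by (simp add: prob_algebra_def subprob_algebra_cong[of \<nu> \<mu>] cong: measurable_cong_sets)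
  fix h :: "'a \<times> 'a \<Rightarrow> ennreal" assume "h \<in> borel_measurable (\<nu> \<Otimes>\<^sub>M \<nu>)"
  then have h[measurable]: "h \<in> borel_measurable (\<mu> \<Otimes>\<^sub>M \<mu>)"
    by (simp cong: measurable_cong_sets)
  interpret P: pair_sigma_finite \<mu> \<mu> ..
  have "(\<integral>\<^sup>+x. \<integral>\<^sup>+y. flow x y * h (x, y) \<partial>\<mu> \<partial>\<mu>) = (\<integral>\<^sup>+y. \<integral>\<^sup>+x. flow x y * h (x, y) \<partial>\<mu> \<partial>\<mu>)"
    by (rule P.Fubini'[symmetric]) measurable
  also have "\<dots> = (\<integral>\<^sup>+x. \<integral>\<^sup>+y. flow x y * h (y, x) \<partial>\<mu> \<partial>\<mu>)"
    by (subst flow_sym) (rule refl)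
  finally show "(\<integral>\<^sup>+x. \<integral>\<^sup>+y. h (x, y) \<partial>K x \<partial>\<nu>) = (\<integral>\<^sup>+x. \<integral>\<^sup>+y. h (y, x) \<partial>K x \<partial>\<nu>)"
    using nn_integral_chain[of h] nn_integral_chain[of "\<lambda>(x, y). h (y, x)"] by simp
qed

lemma dirichlet_form_K:
  assumes "f \<in> borel_measurable \<mu>"
  shows "(\<integral>\<^sup>+x. \<integral>\<^sup>+y. ennreal ((f x - f y)\<^sup>2) \<partial>K x \<partial>\<nu>)
    = (\<integral>\<^sup>+x. \<integral>\<^sup>+y. flow x y * ennreal ((f x - f y)\<^sup>2) \<partial>\<mu> \<partial>\<mu>)"
  using nn_integral_chain[of "\<lambda>(x, y). ennreal ((f x - f y)\<^sup>2)"] assms by simp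

section \<open>Metropolis-within-Gibbs as a special case\<close>

abbreviation MwG_chain where "MwG_chain \<equiv> P_MwG \<mu> \<mu>1 \<pi> p1 q"

text \<open>With counting measure on one point and density 1, the second auxiliary variable carries
  no randomness. Reversibility and the flow formula then hold for the Metropolis-within-Gibbs chain
  by instantiation.\<close>

lemma aux_mcmc_trivial: "aux_mcmc \<mu> \<mu>1 (count_space (UNIV :: unit set)) \<pi> p1 (\<lambda>_ _ _ _. 1) q"
proof (rule aux_mcmc.intro)
  show "sigma_finite_measure (count_space (UNIV :: unit set))"
    by (intro sigma_finite_measure_count_space_finite) simp
  show "prob_space (rdensity (count_space (UNIV :: unit set)) (\<lambda>_. 1))"
    by (intro prob_spaceI) (simp add: emeasure_density)
qed (use sigma_finite measurable_target measurable_p1 measurable_q nonneg_target nonneg_p1 nonneg_q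
  prob_target prob_p1 prob_q in \<open>simp_all\<close>)

text \<open>With \<open>p2\<close> constant, the acceptance step no longer depends on
  \<open>\<omega>2\<close>, and binding a probability measure to a constant kernel returns the
  constant.\<close>

lemma P_MwG_eq_P_aux:
  assumes "\<theta> \<in> space \<mu>"
  shows "MwG_chain \<theta> = P_aux \<mu> \<mu>1 (count_space (UNIV :: unit set)) \<pi> p1 (\<lambda>_ _ _ _. 1) q \<theta>"
proof -
  have "prob_space (rdensity (count_space (UNIV :: unit set)) (\<lambda>_. 1))"
    by (intro prob_spaceI) (simp add: emeasure_density)
  note const = bind_const'[OF this prob_space_imp_subprob_space[OF prob_space_accept_step]]
  show ?thesis
    unfolding P_MwG_def P_aux_def joint_density_def using assms
    by (intro bind_cong refl) (simp add: const[simplified])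
qed

interpretation MwG: aux_mcmc \<mu> \<mu>1 "count_space (UNIV :: unit set)" \<pi> p1 "\<lambda>_ _ _ _. 1" q
  by (rule aux_mcmc_trivial)

lemma MwG_flow: "MwG.flow \<theta> \<theta>' =
  (\<integral>\<^sup>+\<omega>1. ennreal (min (\<pi> \<theta> * p1 \<theta> \<omega>1 * q \<omega>1 \<theta> \<theta>') (\<pi> \<theta>' * p1 \<theta>' \<omega>1 * q \<omega>1 \<theta>' \<theta>)) \<partial>\<mu>1)"
  unfolding MwG.flow_def MwG.weight_def joint_density_def by simp

section \<open>Comparison of flows through the overlap\<close>

text \<open>For probability densities this is 1 minus the total variation distance of the two
  conditional laws.\<close>

definition overlap where
  "overlap \<theta> \<theta>' \<omega>1 = (\<integral>\<omega>2. min (p2 \<theta> \<theta>' \<omega>1 \<omega>2) (p2 \<theta>' \<theta> \<omega>1 \<omega>2) \<partial>\<mu>2)"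

lemma p2_density:
  assumes "\<theta> \<in> space \<mu>" "\<theta>' \<in> space \<mu>" "\<omega>1 \<in> space \<mu>1"
  shows "p2 \<theta> \<theta>' \<omega>1 \<in> borel_measurable \<mu>2" "\<And>\<omega>2. \<omega>2 \<in> space \<mu>2 \<Longrightarrow> 0 \<le> p2 \<theta> \<theta>' \<omega>1 \<omega>2"
    "prob_space (rdensity \<mu>2 (p2 \<theta> \<theta>' \<omega>1))"
    "integrable \<mu>2 (p2 \<theta> \<theta>' \<omega>1)" "integral\<^sup>L \<mu>2 (p2 \<theta> \<theta>' \<omega>1) = 1"
proof -
  show 1: "p2 \<theta> \<theta>' \<omega>1 \<in> borel_measurable \<mu>2"
    using assms by measurable
  show 2: "0 \<le> p2 \<theta> \<theta>' \<omega>1 \<omega>2" if "\<omega>2 \<in> space \<mu>2" for \<omega>2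
    using assms that by (rule nonneg_p2)
  show 3: "prob_space (rdensity \<mu>2 (p2 \<theta> \<theta>' \<omega>1))"
    using assms by (rule prob_p2)
  show "integrable \<mu>2 (p2 \<theta> \<theta>' \<omega>1)" "integral\<^sup>L \<mu>2 (p2 \<theta> \<theta>' \<omega>1) = 1"
    using integrable_probability_density[OF 1 2 3] by auto
qed

text \<open>The two weights are \<open>a * p2 \<theta> \<theta>'\<close> and
  \<open>b * p2 \<theta>' \<theta>\<close>. Keeping only one of them in the minimum and integrating
  the density to 1 gives the upper bound; the lower one holds because both dominate
  \<open>min a b\<close> times the minimum of the densities.\<close>

lemma nn_integral_weight_bounds:
  assumes w: "\<theta> \<in> space \<mu>" "\<theta>' \<in> space \<mu>" "\<omega>1 \<in> space \<mu>1"
  defines "m \<equiv> min (\<pi> \<theta> * p1 \<theta> \<omega>1 * q \<omega>1 \<theta> \<theta>') (\<pi> \<theta>' * p1 \<theta>' \<omega>1 * q \<omega>1 \<theta>' \<theta>)"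
  defines "I \<equiv> (\<integral>\<^sup>+\<omega>2. ennreal (min (weight \<theta> \<theta>' \<omega>1 \<omega>2) (weight \<theta>' \<theta> \<omega>1 \<omega>2)) \<partial>\<mu>2)"
  shows "I \<le> ennreal m" and "ennreal (overlap \<theta> \<theta>' \<omega>1 * m) \<le> I"
proof -
  define a where "a = \<pi> \<theta> * p1 \<theta> \<omega>1 * q \<omega>1 \<theta> \<theta>'"
  define b where "b = \<pi> \<theta>' * p1 \<theta>' \<omega>1 * q \<omega>1 \<theta>' \<theta>"
  have m: "m = min a b" by (simp add: m_def a_def b_def)
  have ab: "0 \<le> a" "0 \<le> b"
    unfolding a_def b_def using w by (auto intro!: mult_nonneg_nonneg nonneg_target nonneg_p1 nonneg_q)
  note d = p2_density[OF w] and d' = p2_density[OF w(2,1,3)]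
  have I: "I = (\<integral>\<^sup>+\<omega>2. ennreal (min (a * p2 \<theta> \<theta>' \<omega>1 \<omega>2) (b * p2 \<theta>' \<theta> \<omega>1 \<omega>2)) \<partial>\<mu>2)"
    unfolding I_def weight_def joint_density_def a_def b_def by (simp add: mult_ac)
  have total: "(\<integral>\<^sup>+\<omega>2. ennreal (c * p2 x y \<omega>1 \<omega>2) \<partial>\<mu>2) = ennreal c"
    if "0 \<le> c" "x \<in> space \<mu>" "y \<in> space \<mu>" for c x y
  proof -
    note e = p2_density[OF that(2,3) w(3)]
    have "(\<integral>\<^sup>+\<omega>2. ennreal (c * p2 x y \<omega>1 \<omega>2) \<partial>\<mu>2) = ennreal (\<integral>\<omega>2. c * p2 x y \<omega>1 \<omega>2 \<partial>\<mu>2)"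
      using that e by (intro nn_integral_eq_integral) auto
    then show ?thesis using e(5) by simp
  qed
  have "I \<le> ennreal a"
    unfolding I total[OF ab(1) w(1,2), symmetric] by (intro nn_integral_mono ennreal_leI) simp
  moreover have "I \<le> ennreal b"
    unfolding I total[OF ab(2) w(2,1), symmetric] by (intro nn_integral_mono ennreal_leI) simp
  ultimately show "I \<le> ennreal m" by (simp add: m min_def)
  have "ennreal (overlap \<theta> \<theta>' \<omega>1 * m) = ennreal (\<integral>\<omega>2. m * min (p2 \<theta> \<theta>' \<omega>1 \<omega>2) (p2 \<theta>' \<theta> \<omega>1 \<omega>2) \<partial>\<mu>2)"
    by (simp add: overlap_def mult.commute)
  also have "\<dots> = (\<integral>\<^sup>+\<omega>2. ennreal (m * min (p2 \<theta> \<theta>' \<omega>1 \<omega>2) (p2 \<theta>' \<theta> \<omega>1 \<omega>2)) \<partial>\<mu>2)"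
    using ab d d' by (intro nn_integral_eq_integral[symmetric]) (auto simp: m)
  also have "\<dots> \<le> I"
    unfolding I using ab d(2) d'(2)
    by (intro nn_integral_mono ennreal_leI min.boundedI) (auto simp: m intro!: mult_mono)
  finally show "ennreal (overlap \<theta> \<theta>' \<omega>1 * m) \<le> I" .
qed

text \<open>Common core of the two bounds: integrated over \<open>\<omega>1\<close>, the weight
  bounds place \<open>flow\<close> between \<open>c\<close> times the Metropolis-within-Gibbs flow
  and that flow, which is the input of \<open>Gap_comparison\<close>.\<close>

lemma Gap_ge_of_overlap_ge:
  assumes c: "0 \<le> c" "c \<le> 1"
    and overlap: "\<And>\<theta> \<theta>' \<omega>1. \<lbrakk>\<theta> \<in> space \<mu>; \<theta>' \<in> space \<mu>; \<omega>1 \<in> space \<mu>1\<rbrakk> \<Longrightarrow> c \<le> overlap \<theta> \<theta>' \<omega>1"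
  shows "c * Gap \<nu> MwG_chain \<le> Gap \<nu> K"
proof -
  have flow_le: "flow \<theta> \<theta>' \<le> MwG.flow \<theta> \<theta>'" if "\<theta> \<in> space \<mu>" "\<theta>' \<in> space \<mu>" for \<theta> \<theta>'
    unfolding MwG_flow flow_def using that by (intro nn_integral_mono nn_integral_weight_bounds(1))
  have flow_ge: "ennreal c * MwG.flow \<theta> \<theta>' \<le> flow \<theta> \<theta>'" if \<theta>: "\<theta> \<in> space \<mu>" "\<theta>' \<in> space \<mu>" for \<theta> \<theta>'
  proof -
    note [measurable] = measurable_const[OF \<theta>(1)] measurable_const[OF \<theta>(2)]
    let ?m = "\<lambda>\<omega>1. min (\<pi> \<theta> * p1 \<theta> \<omega>1 * q \<omega>1 \<theta> \<theta>') (\<pi> \<theta>' * p1 \<theta>' \<omega>1 * q \<omega>1 \<theta>' \<theta>)"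
    have "ennreal c * MwG.flow \<theta> \<theta>' = (\<integral>\<^sup>+\<omega>1. ennreal c * ennreal (?m \<omega>1) \<partial>\<mu>1)"
      unfolding MwG_flow by (rule nn_integral_cmult[symmetric]) measurable
    also have "\<dots> \<le> flow \<theta> \<theta>'"
      unfolding flow_def
    proof (intro nn_integral_mono)
      fix \<omega>1 assume w: "\<omega>1 \<in> space \<mu>1"
      have m: "0 \<le> ?m \<omega>1"
        using \<theta> w by (auto intro!: mult_nonneg_nonneg nonneg_target nonneg_p1 nonneg_q)
      have "ennreal c * ennreal (?m \<omega>1) \<le> ennreal (overlap \<theta> \<theta>' \<omega>1 * ?m \<omega>1)"
        using c m overlap[OF \<theta> w] by (auto simp flip: ennreal_mult intro!: ennreal_leI mult_right_mono)
      also note nn_integral_weight_bounds(2)[OF \<theta> w]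
      finally show "ennreal c * ennreal (?m \<omega>1)
        \<le> (\<integral>\<^sup>+\<omega>2. ennreal (min (weight \<theta> \<theta>' \<omega>1 \<omega>2) (weight \<theta>' \<theta> \<omega>1 \<omega>2)) \<partial>\<mu>2)" .
    qed
    finally show ?thesis .
  qed
  have "c * Gap \<nu> MwG.K \<le> Gap \<nu> K"
  proof (rule Gap_comparison[OF MwG.reversible_K reversible_K c])
    fix f :: "'a \<Rightarrow> real" assume "f \<in> borel_measurable \<nu>"
    then have f[measurable]: "f \<in> borel_measurable \<mu>" by simp
    have "ennreal c * (\<integral>\<^sup>+x. \<integral>\<^sup>+y. MwG.flow x y * ennreal ((f x - f y)\<^sup>2) \<partial>\<mu> \<partial>\<mu>)
      = (\<integral>\<^sup>+x. ennreal c * (\<integral>\<^sup>+y. MwG.flow x y * ennreal ((f x - f y)\<^sup>2) \<partial>\<mu>) \<partial>\<mu>)"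
      by (rule nn_integral_cmult[symmetric]) measurable
    also have "\<dots> \<le> (\<integral>\<^sup>+x. \<integral>\<^sup>+y. flow x y * ennreal ((f x - f y)\<^sup>2) \<partial>\<mu> \<partial>\<mu>)"
    proof (intro nn_integral_mono)
      fix x assume x: "x \<in> space \<mu>"
      note [measurable] = measurable_const[OF x]
      have "ennreal c * (\<integral>\<^sup>+y. MwG.flow x y * ennreal ((f x - f y)\<^sup>2) \<partial>\<mu>)
        = (\<integral>\<^sup>+y. ennreal c * (MwG.flow x y * ennreal ((f x - f y)\<^sup>2)) \<partial>\<mu>)"
        by (rule nn_integral_cmult[symmetric]) measurable
      also have "\<dots> \<le> (\<integral>\<^sup>+y. flow x y * ennreal ((f x - f y)\<^sup>2) \<partial>\<mu>)"
        using flow_ge x by (intro nn_integral_mono) (auto simp: mult.assoc[symmetric] intro!: mult_right_mono)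
      finally show "ennreal c * (\<integral>\<^sup>+y. MwG.flow x y * ennreal ((f x - f y)\<^sup>2) \<partial>\<mu>)
        \<le> (\<integral>\<^sup>+y. flow x y * ennreal ((f x - f y)\<^sup>2) \<partial>\<mu>)" .
    qed
    finally show "ennreal c * (\<integral>\<^sup>+x. \<integral>\<^sup>+y. ennreal ((f x - f y)\<^sup>2) \<partial>MwG.K x \<partial>\<nu>)
      \<le> (\<integral>\<^sup>+x. \<integral>\<^sup>+y. ennreal ((f x - f y)\<^sup>2) \<partial>K x \<partial>\<nu>)"
      unfolding dirichlet_form_K[OF f] MwG.dirichlet_form_K[OF f] .
    show "(\<integral>\<^sup>+x. \<integral>\<^sup>+y. ennreal ((f x - f y)\<^sup>2) \<partial>K x \<partial>\<nu>)
      \<le> (\<integral>\<^sup>+x. \<integral>\<^sup>+y. ennreal ((f x - f y)\<^sup>2) \<partial>MwG.K x \<partial>\<nu>)"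
      unfolding dirichlet_form_K[OF f] MwG.dirichlet_form_K[OF f]
      by (intro nn_integral_mono mult_right_mono flow_le) auto
  qed
  \<comment> \<open>The equality of the two kernels is known on \<open>space \<mu>\<close>, the only
    place where the norms evaluate them.\<close>
  moreover have "Gap \<nu> MwG_chain = Gap \<nu> MwG.K"
  proof -
    have "L2_norm \<nu> (kernel_op MwG_chain f) = L2_norm \<nu> (kernel_op MwG.K f)" for f
      unfolding L2_norm_def kernel_op_def
      by (intro arg_cong[where f=sqrt] Bochner_Integration.integral_cong) (simp_all add: P_MwG_eq_P_aux)
    then show ?thesis by (simp add: Gap_def op_norm_L2_0_def)
  qed
  ultimately show ?thesis by simp
qed

section \<open>Total variation and Kullback-Leibler bounds for the gap\<close>

lemma dTV_le_dTV_aux: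
  assumes w: "\<theta> \<in> space \<mu>" "\<theta>' \<in> space \<mu>"
  shows "\<omega>1 \<in> space \<mu>1 \<Longrightarrow>
      dTV (rdensity \<mu>2 (p2 \<theta> \<theta>' \<omega>1)) (rdensity \<mu>2 (p2 \<theta>' \<theta> \<omega>1)) \<le> dTV_aux \<mu>1 \<mu>2 p2 \<theta> \<theta>'"
    and "0 \<le> dTV_aux \<mu>1 \<mu>2 p2 \<theta> \<theta>'" and "dTV_aux \<mu>1 \<mu>2 p2 \<theta> \<theta>' \<le> 1"
proof -
  have b: "0 \<le> dTV (rdensity \<mu>2 (p2 \<theta> \<theta>' \<omega>)) (rdensity \<mu>2 (p2 \<theta>' \<theta> \<omega>))"
    "dTV (rdensity \<mu>2 (p2 \<theta> \<theta>' \<omega>)) (rdensity \<mu>2 (p2 \<theta>' \<theta> \<omega>)) \<le> 1" if "\<omega> \<in> space \<mu>1" for \<omega>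
    using dTV_bounds[OF prob_p2[OF w that] prob_p2[OF w(2,1) that]] by auto
  have up: "dTV (rdensity \<mu>2 (p2 \<theta> \<theta>' \<omega>)) (rdensity \<mu>2 (p2 \<theta>' \<theta> \<omega>)) \<le> dTV_aux \<mu>1 \<mu>2 p2 \<theta> \<theta>'"
    if "\<omega> \<in> space \<mu>1" for \<omega>
    unfolding dTV_aux_def using that b by (intro cSUP_upper bdd_aboveI[of _ 1]) auto
  then show "\<omega>1 \<in> space \<mu>1 \<Longrightarrow>
      dTV (rdensity \<mu>2 (p2 \<theta> \<theta>' \<omega>1)) (rdensity \<mu>2 (p2 \<theta>' \<theta> \<omega>1)) \<le> dTV_aux \<mu>1 \<mu>2 p2 \<theta> \<theta>'" .
  \<comment> \<open>The real supremum over \<open>\<omega>1\<close> needs a nonempty index set; a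
    space that carries a probability measure has a point.\<close>
  have ne: "space \<mu>1 \<noteq> {}"
    using prob_space.not_empty[OF prob_p1[OF w(1)]] by simp
  then obtain \<omega> where "\<omega> \<in> space \<mu>1" by auto
  from b(1)[OF this] up[OF this] show "0 \<le> dTV_aux \<mu>1 \<mu>2 p2 \<theta> \<theta>'" by linarith
  show "dTV_aux \<mu>1 \<mu>2 p2 \<theta> \<theta>' \<le> 1"
    unfolding dTV_aux_def using ne b by (intro cSUP_least) auto
qed

lemma Gap_ge_TV:
  "(1 - (SUP (\<theta>, \<theta>') \<in> space \<mu> \<times> space \<mu>. dTV_aux \<mu>1 \<mu>2 p2 \<theta> \<theta>')) * Gap \<nu> MwG_chain \<le> Gap \<nu> K"
proof (rule Gap_ge_of_overlap_ge)
  let ?S = "SUP (\<theta>, \<theta>') \<in> space \<mu> \<times> space \<mu>. dTV_aux \<mu>1 \<mu>2 p2 \<theta> \<theta>'"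
  have up: "dTV_aux \<mu>1 \<mu>2 p2 \<theta> \<theta>' \<le> ?S" if "\<theta> \<in> space \<mu>" "\<theta>' \<in> space \<mu>" for \<theta> \<theta>'
    using that dTV_le_dTV_aux(3)
    by (intro cSUP_upper2[where x="(\<theta>, \<theta>')"] bdd_aboveI[of _ 1]) auto
  obtain \<theta> where \<theta>: "\<theta> \<in> space \<mu>"
    using prob_space.not_empty[OF prob_target] by auto
  show "1 - ?S \<le> 1"
    using up[OF \<theta> \<theta>] dTV_le_dTV_aux(2)[OF \<theta> \<theta>] by linarith
  have "?S \<le> 1"
    using \<theta> dTV_le_dTV_aux(3) by (intro cSUP_least) auto
  then show "0 \<le> 1 - ?S" by simp
  fix \<theta> \<theta>' \<omega>1 assume w: "\<theta> \<in> space \<mu>" "\<theta>' \<in> space \<mu>" "\<omega>1 \<in> space \<mu>1"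
  have "1 - ?S \<le> 1 - dTV (rdensity \<mu>2 (p2 \<theta> \<theta>' \<omega>1)) (rdensity \<mu>2 (p2 \<theta>' \<theta> \<omega>1))"
    using up[OF w(1,2)] dTV_le_dTV_aux(1)[OF w] by linarith
  also have "\<dots> \<le> overlap \<theta> \<theta>' \<omega>1"
    unfolding overlap_def
    by (rule overlap_ge_dTV[OF p2_density(1-3)[OF w] p2_density(1-3)[OF w(2,1,3)]])
  finally show "1 - ?S \<le> overlap \<theta> \<theta>' \<omega>1" .
qed

text \<open>The overlap is symmetric in the two densities, so it is bounded below through either
  directed divergence, hence through the smaller one at the given \<open>\<omega>1\<close>. Each of
  the three suprema dominates that smaller one.\<close>

lemma Gap_ge_KL:
  "exp (- 1 / exp 1) * exp_minus (SUP (\<theta>, \<theta>') \<in> {(\<theta>, \<theta>'). \<theta> \<in> space \<mu> \<and> \<theta>' \<in> space \<mu> \<and> \<theta> \<noteq> \<theta>'}.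
      Min {dKL_aux \<mu>1 \<mu>2 p2 \<theta> \<theta>', dKL_tilde_aux \<mu>1 \<mu>2 p2 \<theta> \<theta>', dKL_tilde_aux \<mu>1 \<mu>2 p2 \<theta>' \<theta>})
    * Gap \<nu> MwG_chain \<le> Gap \<nu> K"
  (is "?e * exp_minus ?S * _ \<le> _")
proof (rule Gap_ge_of_overlap_ge)
  show "0 \<le> ?e * exp_minus ?S" by (simp add: exp_minus_bounds)
  show le1: "?e * exp_minus ?S \<le> 1" by (intro mult_le_one) (simp_all add: exp_minus_bounds)
  fix \<theta> \<theta>' \<omega>1 assume w: "\<theta> \<in> space \<mu>" "\<theta>' \<in> space \<mu>" "\<omega>1 \<in> space \<mu>1"
  show "?e * exp_minus ?S \<le> overlap \<theta> \<theta>' \<omega>1"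
  \<comment> \<open>The supremum ranges over distinct states, so the diagonal is treated apart:
    there the two conditional densities coincide and the overlap is 1.\<close>
  proof (cases "\<theta> = \<theta>'")
    case True
    then show ?thesis using le1 p2_density(5)[OF w] by (simp add: overlap_def)
  next
    case False
    define D where "D x y = dKL (rdensity \<mu>2 (p2 x y \<omega>1)) (rdensity \<mu>2 (p2 y x \<omega>1))" for x y
    have D: "?e * exp_minus (D \<theta> \<theta>') \<le> overlap \<theta> \<theta>' \<omega>1" "?e * exp_minus (D \<theta>' \<theta>) \<le> overlap \<theta> \<theta>' \<omega>1"
      using overlap_ge_dKL[OF p2_density(1-3)[OF w] p2_density(1-3)[OF w(2,1,3)] sigma_finite(3)]
        overlap_ge_dKL[OF p2_density(1-3)[OF w(2,1,3)] p2_density(1-3)[OF w] sigma_finite(3)]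
      unfolding D_def overlap_def by (simp_all add: min.commute)
    have tilde: "D x y \<le> dKL_tilde_aux \<mu>1 \<mu>2 p2 x y" for x y
      unfolding D_def dKL_tilde_aux_def by (rule SUP_upper[OF w(3)])
    have "(D \<theta> \<theta>' + D \<theta>' \<theta>) / 2 \<le> dKL_aux \<mu>1 \<mu>2 p2 \<theta> \<theta>'"
      unfolding D_def dKL_aux_def
      by (rule divide_right_mono_ennreal[OF SUP_upper[OF w(3)]])
    then have sym: "min (D \<theta> \<theta>') (D \<theta>' \<theta>) \<le> dKL_aux \<mu>1 \<mu>2 p2 \<theta> \<theta>'"
      using min_le_half_sum_ennreal order_trans by blast
    have "min (D \<theta> \<theta>') (D \<theta>' \<theta>)
      \<le> Min {dKL_aux \<mu>1 \<mu>2 p2 \<theta> \<theta>', dKL_tilde_aux \<mu>1 \<mu>2 p2 \<theta> \<theta>', dKL_tilde_aux \<mu>1 \<mu>2 p2 \<theta>' \<theta>}"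
      using sym tilde[of \<theta> \<theta>'] tilde[of \<theta>' \<theta>] by (auto intro: min.coboundedI1 min.coboundedI2)
    also have "\<dots> \<le> ?S"
      using w False by (intro SUP_upper2[where i="(\<theta>, \<theta>')"]) auto
    finally have "exp_minus ?S \<le> exp_minus (min (D \<theta> \<theta>') (D \<theta>' \<theta>))"
      by (rule exp_minus_antimono)
    then have "?e * exp_minus ?S \<le> ?e * exp_minus (min (D \<theta> \<theta>') (D \<theta>' \<theta>))"
      by (rule mult_left_mono) simp
    also have "\<dots> \<le> overlap \<theta> \<theta>' \<omega>1"
      using D by (simp add: min_def)
    finally show ?thesis .
  qed
qed

end

theorem theorem2:
  fixes \<mu> :: "'a measure" and \<mu>1 :: "'b measure" and \<mu>2 :: "'c measure"
    and \<pi> :: "'a \<Rightarrow> real"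
    and p1 :: "'a \<Rightarrow> 'b \<Rightarrow> real"
    and p2 :: "'a \<Rightarrow> 'a \<Rightarrow> 'b \<Rightarrow> 'c \<Rightarrow> real"
    and q :: "'b \<Rightarrow> 'a \<Rightarrow> 'a \<Rightarrow> real"
  assumes "aux_mcmc \<mu> \<mu>1 \<mu>2 \<pi> p1 p2 q"
  shows
    "Gap (rdensity \<mu> \<pi>) (P_aux \<mu> \<mu>1 \<mu>2 \<pi> p1 p2 q)
      \<ge> (1 - (SUP (\<theta>, \<theta>') \<in> space \<mu> \<times> space \<mu>. dTV_aux \<mu>1 \<mu>2 p2 \<theta> \<theta>'))
          * Gap (rdensity \<mu> \<pi>) (P_MwG \<mu> \<mu>1 \<pi> p1 q)
    \<and> Gap (rdensity \<mu> \<pi>) (P_aux \<mu> \<mu>1 \<mu>2 \<pi> p1 p2 q)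
      \<ge> exp (- 1 / exp 1)
          * exp_minus (SUP (\<theta>, \<theta>') \<in> {(\<theta>, \<theta>'). \<theta> \<in> space \<mu> \<and> \<theta>' \<in> space \<mu> \<and> \<theta> \<noteq> \<theta>'}.
              Min {dKL_aux \<mu>1 \<mu>2 p2 \<theta> \<theta>', dKL_tilde_aux \<mu>1 \<mu>2 p2 \<theta> \<theta>',
                   dKL_tilde_aux \<mu>1 \<mu>2 p2 \<theta>' \<theta>})
          * Gap (rdensity \<mu> \<pi>) (P_MwG \<mu> \<mu>1 \<pi> p1 q)"
proof -
  interpret aux_mcmc \<mu> \<mu>1 \<mu>2 \<pi> p1 p2 q by fact
  show ?thesis
    using Gap_ge_TV Gap_ge_KL by blast
qed

end
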